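(* Let $\{\mathcal{T}(t)\}_{t\ge 0}$ be the symmetric telegraph process with speed $c>0$ and rate $\lambda>0$, and let $t>0$. For all integers $m\ge 1$ and $k\ge 0$, $$\mathbb{E}\Bigl[ \bigl(\max_{0\le s\le t} \mathcal{T}(s)\bigr)^m \,\Big|\, V(0) = -c,\ N(t) = 2k\Bigr] = \frac{(2k)!\,(ct)^m}{2^{2k}\,k!} \Biggl[\frac{\Gamma\bigl(\frac{m+1}{2}\bigr)}{\Gamma\bigl(k+\frac{m+1}{2}\bigr)} -\frac{\Gamma\bigl(\frac{m}{2}+1\bigr)}{\Gamma\bigl(k+1+\frac{m}{2}\bigr)}\Biggr].$$ In particular, for $m=1$, $$\mathbb{E}\Bigl[ \max_{0\le s\le t} \mathcal{T}(s) \,\Big|\, V(0) = -c,\ N(t) = 2k\Bigr] = ct\,\frac{(2k)!}{k!^2\,2^{2k}}-\frac{ct}{2k+1} = ct\, P\Bigl\{ \max_{0\le s\le t} \mathcal{T}(s) = 0 \,\Big|\, V(0) = -c,\ N(t) = 2k\Bigr\} - \frac{ct}{2k+1} .$$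
   Context: Let $c>0$, $\lambda>0$. Let $V(0)$ be a random variable with $P\{V(0)=c\}=P\{V(0)=-c\}=\tfrac12$ and let $\{N(t)\}_{t\ge0}$ be a homogeneous Poisson process with rate $\lambda$, independent of $V(0)$. The symmetric telegraph process is $\mathcal{T}(t)=\int_0^t V(0)(-1)^{N(s)}\,ds$, $t\ge 0$ (so $\mathcal{T}(0)=0$). $\Gamma$ is the Euler gamma function. *)

theory Defs
  imports "HOL-Probability.Probability"
begin

(* All paths, and not only almost all of them, are counting paths, so that path functionals
   such as the telegraph process and its maximum are random variables although M need not
   be complete. Since paths are nondecreasing, the subtraction on nat below never truncates. *)
locale homogeneous_poisson_process = prob_space M for M :: "'a measure" +
  fixes rate :: real and N :: "real \<Rightarrow> 'a \<Rightarrow> nat"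
  assumes rate_pos: "0 < rate"
    and random_variable_N: "\<And>t. 0 \<le> t \<Longrightarrow> N t \<in> measurable M (count_space UNIV)"
    and N_zero: "\<And>\<omega>. \<omega> \<in> space M \<Longrightarrow> N 0 \<omega> = 0"
    and N_mono: "\<And>\<omega>. \<omega> \<in> space M \<Longrightarrow> mono_on {0..} (\<lambda>t. N t \<omega>)"
    and N_right_continuous:
      "\<And>\<omega> t. \<omega> \<in> space M \<Longrightarrow> 0 \<le> t \<Longrightarrow> continuous (at_right t) (\<lambda>s. N s \<omega>)"
    and independent_increments:
      "\<And>(n :: nat) (\<tau> :: nat \<Rightarrow> real). 0 \<le> \<tau> 0 \<Longrightarrow> (\<And>i. i < n \<Longrightarrow> \<tau> i \<le> \<tau> (Suc i)) \<Longrightarrow>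
         indep_vars (\<lambda>_. count_space UNIV) (\<lambda>i \<omega>. N (\<tau> (Suc i)) \<omega> - N (\<tau> i) \<omega>) {..<n}"
    and poisson_increments:
      "\<And>s t. 0 \<le> s \<Longrightarrow> s < t \<Longrightarrow>
         distr M (count_space UNIV) (\<lambda>\<omega>. N t \<omega> - N s \<omega>) =
         measure_pmf (poisson_pmf (rate * (t - s)))"

(* V0_indep_N: indep_var does not apply to random variables of different types, so
   independence of V0 and the whole process N is that of the generated sigma-algebras. *)
locale symmetric_telegraph = homogeneous_poisson_process M rate N
  for M :: "'a measure" and rate :: real and N :: "real \<Rightarrow> 'a \<Rightarrow> nat" +
  fixes c :: real and V0 :: "'a \<Rightarrow> real"
  assumes speed_pos: "0 < c"
    and random_variable_V0: "random_variable borel V0"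
    and prob_V0_plus: "\<P>(\<omega> in M. V0 \<omega> = c) = 1 / 2"
    and prob_V0_minus: "\<P>(\<omega> in M. V0 \<omega> = - c) = 1 / 2"
    and V0_indep_N:
      "indep_set (sets (vimage_algebra (space M) V0 borel))
         (sets (vimage_algebra (space M) (\<lambda>\<omega>. \<lambda>s\<in>{0..}. N s \<omega>) (PiM {0..} (\<lambda>_. count_space UNIV))))"

definition telegraph :: "('a \<Rightarrow> real) \<Rightarrow> (real \<Rightarrow> 'a \<Rightarrow> nat) \<Rightarrow> real \<Rightarrow> 'a \<Rightarrow> real" where
  "telegraph V0 N t \<omega> = (LINT s:{0..t}|lborel. V0 \<omega> * (- 1) ^ N s \<omega>)"

definition running_max :: "(real \<Rightarrow> 'a \<Rightarrow> real) \<Rightarrow> real \<Rightarrow> 'a \<Rightarrow> real" where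
  "running_max X t \<omega> = (GREATEST y. y \<in> (\<lambda>s. X s \<omega>) ` {0..t})"

(* Conditional expectation given an event of positive probability: the expectation
   under the conditional law; the counterpart of cond_prob. *)
definition cond_expectation :: "'a measure \<Rightarrow> ('a \<Rightarrow> real) \<Rightarrow> ('a \<Rightarrow> bool) \<Rightarrow> real" where
  "cond_expectation M X Q = (LINT \<omega>|uniform_measure M {\<omega> \<in> space M. Q \<omega>}. X \<omega>)"

end

(* Sample the process on a grid of mesh h = t / n. Up to events of vanishing probability, V(0) = -c
   and N(t) = 2k make the word of turns uniform on the words of length n with 2k turns, so that the
   conditional law of the maximum is the limit of that of a persistent random walk.

   Such a walk starts and ends with a down step. Cut it before the step by which it first reaches
   x > 0, and traverse the rest backwards. The rest begins with an up step and ends with a down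
   step, and so does its reversal; hence the number of turns and the first passage survive, while
   the end point y becomes 2 (x - 1) - y. This is a reflection principle within a fixed number of
   turns: #(max >= x) = #(end >= x) + #(end >= x - 1). In the limit
   P(max > x) = 2 P(T(t) > x), and end points are counted by pairs of compositions.
   The conditional law of max / (ct) therefore has on (0, 1) the density
   (2k)! / (k! (k-1)! 2^(2k-1)) (1 - x) (1 - x^2)^(k-1), whose moments are Beta integrals,
   and its missing mass is the atom at 0. *)

theory Submission
  imports Defs
begin

section \<open>Walks with a given number of turns\<close>

text \<open>Conditioning on N(t) = 2k in continuous time would involve the joint law of the jump
  times. On a grid of mesh h only finitely many independent Poisson increments enter: a pattern with
  at most one jump in each cell has probability exp(-rate t) (rate h)^j, which depends on the word
  only through its number j of turns. Hence the uniformity, and hence \<open>rate\<close> cancels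
  against the probability of the conditioning event.

  The density is found by means of test functions that are bounded, continuous and zero on the
  nonpositive axis. Continuity allows passing from the grid maximum to the true one, boundedness
  makes cells with several jumps negligible, and vanishing at 0 permits the summation by parts that
  carries the reflection identity from indicators to functions. It also hides the atom, which must
  therefore be recovered as missing mass.

  The last down step matters for the reflection: a walk ending at x - 1 or higher has been at x or
  higher just before.\<close>

definition turn_words :: "nat \<Rightarrow> nat \<Rightarrow> bool list set" where
  "turn_words n j = {bs. length bs = n \<and> count_list bs True = j}"

text \<open>A word records at which steps the velocity turns, so a word of length \<open>n\<close> has \<open>n + 1\<close> velocities,
  the first being \<open>d\<close>. The end point uses all of them, the maximum only the first \<open>n\<close>; the last
  one is a down step wherever it matters.\<close>

fun walk_max :: "int \<Rightarrow> bool list \<Rightarrow> int" where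
  "walk_max d [] = 0"
| "walk_max d (b # bs) = max 0 (d + walk_max (if b then - d else d) bs)"

fun walk_end :: "int \<Rightarrow> bool list \<Rightarrow> int" where
  "walk_end d [] = d"
| "walk_end d (b # bs) = d + walk_end (if b then - d else d) bs"

lemma finite_turn_words [simp]: "finite (turn_words n j)"
proof (rule finite_subset)
  show "turn_words n j \<subseteq> {bs. set bs \<subseteq> UNIV \<and> length bs = n}"
    by (auto simp: turn_words_def)
qed (rule finite_lists_length_eq, simp)

lemma turn_words_0: "turn_words 0 j = (if j = 0 then {[]} else {})"
  by (auto simp: turn_words_def)

lemma turn_words_Suc:
  "turn_words (Suc n) j =
     (#) False ` turn_words n j \<union> (if j = 0 then {} else (#) True ` turn_words n (j - 1))"
proof -
  have "bs \<in> turn_words (Suc n) j \<longleftrightarrow>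
      bs \<in> (#) False ` turn_words n j \<union> (if j = 0 then {} else (#) True ` turn_words n (j - 1))" for bs
    by (cases bs; cases "hd bs") (auto simp: turn_words_def)
  then show ?thesis by blast
qed

lemma sum_turn_words_Suc:
  fixes F :: "bool list \<Rightarrow> 'b :: comm_monoid_add"
  shows "(\<Sum>bs\<in>turn_words (Suc n) j. F bs) =
    (\<Sum>bs\<in>turn_words n j. F (False # bs)) +
    (if j = 0 then 0 else \<Sum>bs\<in>turn_words n (j - 1). F (True # bs))"
proof -
  have inj: "inj_on ((#) b) A" for b and A :: "bool list set" by (simp add: inj_on_def)
  show ?thesis
    unfolding turn_words_Suc
    by (subst sum.union_disjoint) (auto simp: sum.reindex[OF inj])
qed

lemma walk_end_uminus: "walk_end (- d) bs = - walk_end d bs"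
proof (induction bs arbitrary: d)
  case (Cons b bs)
  show ?case using Cons[of d] Cons[of "- d"] by simp
qed simp

lemma walk_end_snoc:
  "walk_end d (bs @ [b]) = walk_end d bs + d * (- 1) ^ count_list bs True * (if b then - 1 else 1)"
  by (induction bs arbitrary: d) auto

text \<open>The reversed word lists the same velocities backwards, up to the global sign that makes
  the first one \<open>d\<close> again. This sign is the parity of the number of turns, so an odd
  number of turns negates the end point.\<close>

lemma walk_end_rev: "walk_end d (rev bs) = (- 1) ^ count_list bs True * walk_end d bs"
proof (induction bs)
  case (Cons b bs)
  then show ?case
    by (cases b) (auto simp: walk_end_snoc walk_end_uminus algebra_simps)
qed simp

lemma sum_walk_end_symmetric:
  assumes "odd j"
  shows "(\<Sum>bs\<in>turn_words n j. F (walk_end d bs)) = (\<Sum>bs\<in>turn_words n j. F (- walk_end d bs))"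
  by (rule sum.reindex_bij_witness[of _ rev rev])
    (use assms in \<open>auto simp: turn_words_def walk_end_rev\<close>)

text \<open>Instead of the bijection, induction on the first step: it shifts \<open>x\<close>, except when an up step
  reaches \<open>x = 1\<close> at once, where the claim is the symmetry of the end point under reversal.\<close>

lemma reflection:
  fixes x d :: int
  assumes "1 \<le> x" and "d = (if even j then - 1 else 1)"
  shows "(\<Sum>bs\<in>turn_words n j. of_bool (x \<le> walk_max d bs)) =
    (\<Sum>bs\<in>turn_words n j. of_bool (x \<le> walk_end d bs) + of_bool (x - 1 \<le> walk_end d bs) :: nat)"
  using assms
proof (induction n arbitrary: j x d)
  case 0
  then show ?case by (auto simp: turn_words_0)
next
  case (Suc n)
  show ?case
  proof (cases "x = 1 \<and> d = 1")
    case True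
    then have "odd j" using Suc.prems by (auto split: if_splits)
    have nonneg: "0 \<le> walk_max e bs" for e bs by (cases bs) auto
    have "(\<Sum>bs\<in>turn_words (Suc n) j. of_bool (x \<le> walk_max d bs)) =
        (\<Sum>bs\<in>turn_words (Suc n) j. 1 :: nat)"
      using True nonneg by (intro sum.cong) (auto simp: turn_words_Suc split: if_splits)
    \<comment> \<open>All words count, and each end point is either \<le> -1 or \<ge> 0; the
      symmetry will turn the first alternative into \<ge> 1.\<close>
    also have "\<dots> = (\<Sum>bs\<in>turn_words (Suc n) j.
        of_bool (1 \<le> - walk_end d bs) + of_bool (0 \<le> walk_end d bs))"
      by (intro sum.cong) auto
    also have "\<dots> = (\<Sum>bs\<in>turn_words (Suc n) j.
        of_bool (1 \<le> walk_end d bs) + of_bool (0 \<le> walk_end d bs))"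
      unfolding sum.distrib
      using sum_walk_end_symmetric[OF \<open>odd j\<close>, where F = "\<lambda>y. of_bool (1 \<le> y) :: nat" and n = "Suc n" and d = d] by simp
    finally show ?thesis using True by simp
  next
    case False
    then have x': "1 \<le> x - d" using Suc.prems by (auto split: if_splits)
    have le: "x \<le> max 0 (d + y) \<longleftrightarrow> x - d \<le> y" for y using Suc.prems by auto
    have le': "x \<le> d + y \<longleftrightarrow> x - d \<le> y" "x - 1 \<le> d + y \<longleftrightarrow> x - d - 1 \<le> y" for y by auto
    have F: "(\<Sum>bs\<in>turn_words n j. of_bool (x - d \<le> walk_max d bs)) =
        (\<Sum>bs\<in>turn_words n j.
          of_bool (x - d \<le> walk_end d bs) + of_bool (x - d - 1 \<le> walk_end d bs) :: nat)"
      by (rule Suc.IH) (use x' Suc.prems in auto)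
    \<comment> \<open>A turn changes the velocity and the parity of the remaining turns together, so
      the hypothesis on \<open>d\<close>, which says that the last step is down, is
      preserved.\<close>
    have T: "(\<Sum>bs\<in>turn_words n (j - 1). of_bool (x - d \<le> walk_max (- d) bs)) =
        (\<Sum>bs\<in>turn_words n (j - 1).
          of_bool (x - d \<le> walk_end (- d) bs) + of_bool (x - d - 1 \<le> walk_end (- d) bs) :: nat)"
      if "j \<noteq> 0"
      by (rule Suc.IH) (use x' Suc.prems that in auto)
    show ?thesis
      unfolding sum_turn_words_Suc walk_max.simps walk_end.simps le le' if_True if_False
      using F T by simp
  qed
qed

lemma walk_max_le: "walk_max d bs \<le> \<bar>d\<bar> * int (length bs)"
proof (induction bs arbitrary: d)
  case (Cons b bs)
  show ?case using Cons[of d] Cons[of "- d"] by (cases b) (auto simp: algebra_simps)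
qed simp

lemma walk_end_le: "walk_end d bs \<le> \<bar>d\<bar> * int (length bs + 1)"
proof (induction bs arbitrary: d)
  case (Cons b bs)
  show ?case using Cons[of d] Cons[of "- d"] by (cases b) (auto simp: algebra_simps)
qed simp

text \<open>Summation by parts: a function vanishing on the nonpositive integers is a combination of
  the indicators of x \<le> y with x \<ge> 1, to which \<open>reflection\<close> applies. The
  indicator at level x - 1 reappears as a shift of the end point by 1.\<close>

lemma sum_walk_max_eq_sum_walk_end:
  fixes g :: "int \<Rightarrow> real"
  assumes g: "\<And>y. y \<le> 0 \<Longrightarrow> g y = 0" and "even j"
  shows "(\<Sum>bs\<in>turn_words n j. g (walk_max (- 1) bs)) =
    (\<Sum>bs\<in>turn_words n j. g (walk_end (- 1) bs) + g (walk_end (- 1) bs + 1))"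
proof -
  let ?W = "turn_words n j"
  let ?D = "\<lambda>x. g x - g (x - 1)"
  \<comment> \<open>End points are at most n + 1 and get shifted by 1, so levels up to n + 2
    suffice.\<close>
  let ?X = "{1..int n + 2}"
  have abel: "g y = (\<Sum>x\<in>?X. ?D x * of_bool (x \<le> y))" if "y \<le> int n + 2" for y
  proof (cases "y \<le> 0")
    case True
    then show ?thesis by (auto simp: g)
  next
    case False
    have tele: "(\<Sum>x\<in>{1..int i}. ?D x) = g (int i)" for i
    proof (induction i)
      case (Suc i)
      have "{1..int (Suc i)} = insert (int i + 1) {1..int i}" by auto
      then show ?case using Suc by (simp add: add.commute)
    qed (simp add: g)
    have "(\<Sum>x\<in>?X. ?D x * of_bool (x \<le> y)) = (\<Sum>x\<in>{1..int (nat y)}. ?D x)"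
      using that False by (intro sum.mono_neutral_cong_right) auto
    then show ?thesis using False by (simp only: tele) simp
  qed
  have bnd: "walk_max (- 1) bs \<le> int n + 2" "walk_end (- 1) bs \<le> int n + 1" if "bs \<in> ?W" for bs
    using walk_max_le[of "-1" bs] walk_end_le[of "-1" bs] that by (auto simp: turn_words_def)
  have "(\<Sum>bs\<in>?W. g (walk_max (- 1) bs)) =
      (\<Sum>bs\<in>?W. \<Sum>x\<in>?X. ?D x * of_bool (x \<le> walk_max (- 1) bs))"
    by (intro sum.cong refl abel bnd)
  also have "\<dots> = (\<Sum>x\<in>?X. ?D x * real (\<Sum>bs\<in>?W. of_bool (x \<le> walk_max (- 1) bs)))"
    by (subst sum.swap) (simp add: sum_distrib_left mult.commute)
  also have "\<dots> = (\<Sum>x\<in>?X. ?D x * real (\<Sum>bs\<in>?W. of_bool (x \<le> walk_end (- 1) bs)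
      + of_bool (x - 1 \<le> walk_end (- 1) bs)))"
    using \<open>even j\<close> by (intro sum.cong refl arg_cong2[of _ _ _ _ "(*)"] arg_cong[of _ _ real] reflection) auto
  also have "\<dots> = (\<Sum>bs\<in>?W. (\<Sum>x\<in>?X. ?D x * of_bool (x \<le> walk_end (- 1) bs)) +
      (\<Sum>x\<in>?X. ?D x * of_bool (x \<le> walk_end (- 1) bs + 1)))"
    unfolding sum.distrib[symmetric] by (subst sum.swap) (simp add: sum_distrib_left algebra_simps)
  also have "\<dots> = (\<Sum>bs\<in>?W. g (walk_end (- 1) bs) + g (walk_end (- 1) bs + 1))"
  proof (intro sum.cong refl)
    fix bs assume "bs \<in> ?W"
    with bnd[of bs] show "(\<Sum>x\<in>?X. ?D x * of_bool (x \<le> walk_end (- 1) bs)) +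
      (\<Sum>x\<in>?X. ?D x * of_bool (x \<le> walk_end (- 1) bs + 1)) =
      g (walk_end (- 1) bs) + g (walk_end (- 1) bs + 1)"
      by (intro arg_cong2[of _ _ _ _ "(+)"] abel[symmetric]) auto
  qed
  finally show ?thesis .
qed

section \<open>Counting end points by run lengths\<close>

text \<open>The tail of a word carries one step more than its length, so after a turn, when the two
  directions exchange their roles, the complement is taken in \<open>length bs + 1\<close>.\<close>

fun opposite_steps :: "bool list \<Rightarrow> nat" where
  "opposite_steps [] = 0"
| "opposite_steps (b # bs) = (if b then length bs + 1 - opposite_steps bs else opposite_steps bs)"

lemma opposite_steps_le: "opposite_steps bs \<le> length bs"
  by (induction bs) auto

lemma walk_end_eq: "walk_end d bs = d * (int (length bs) + 1 - 2 * int (opposite_steps bs))"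
proof (induction bs arbitrary: d)
  case (Cons b bs)
  show ?case using opposite_steps_le[of bs] by (auto simp: Cons algebra_simps of_nat_diff)
qed simp

text \<open>Ordered sums of \<open>r\<close> positive parts with total \<open>v\<close>. The zero
  cases are split off because subtraction on \<open>nat\<close> would falsify the binomial
  there.\<close>

definition compositions :: "nat \<Rightarrow> nat \<Rightarrow> nat" where
  "compositions r v = (if r = 0 then of_bool (v = 0) else if v = 0 then 0 else (v - 1) choose (r - 1))"

text \<open>The first part either exceeds 1 and can be shortened, or equals 1 and can be
  removed.\<close>

lemma compositions_Suc_Suc:
  "compositions (Suc r) (Suc v) = compositions (Suc r) v + compositions r v"
  by (cases v; cases r) (auto simp: compositions_def)

text \<open>A walk with \<open>j\<close> turns has \<open>j + 1\<close> runs of alternating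
  direction, \<open>j div 2 + 1\<close> along the first velocity and \<open>(j + 1) div 2\<close>
  against it, and their lengths form two freely chosen compositions. Removing the first step
  shortens or deletes the first run, which is the recursion of
  \<open>compositions_Suc_Suc\<close>.\<close>

lemma count_opposite_steps:
  assumes "v \<le> n + 1"
  shows "(\<Sum>bs\<in>turn_words n j. of_bool (opposite_steps bs = v)) =
    compositions (j div 2 + 1) (n + 1 - v) * compositions ((j + 1) div 2) v"
  using assms
proof (induction n arbitrary: j v)
  case 0
  then have "v = 0 \<or> v = 1" by auto
  then show ?case by (auto simp: turn_words_0 compositions_def)
next
  case (Suc n)
  have F: "(\<Sum>bs\<in>turn_words n j. of_bool (opposite_steps bs = v)) =
      compositions (j div 2 + 1) (n + 1 - v) * compositions ((j + 1) div 2) v"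
  proof (cases "v \<le> n + 1")
    case False
    have "(\<Sum>bs\<in>turn_words n j. of_bool (opposite_steps bs = v)) = (0 :: nat)"
    proof (intro sum.neutral ballI)
      fix bs assume "bs \<in> turn_words n j"
      then show "of_bool (opposite_steps bs = v) = (0 :: nat)"
        using False opposite_steps_le[of bs] by (auto simp: turn_words_def)
    qed
    then show ?thesis using False by (simp add: compositions_def)
  qed (rule Suc.IH)
  show ?case
  proof (cases "v = n + 2")
    case True
    \<comment> \<open>The first step is never opposite, so not all n + 2 steps can be; on the other
      side, 0 has no composition into a positive number of parts.\<close>
    have "(\<Sum>bs\<in>turn_words (Suc n) j. of_bool (opposite_steps bs = v)) = (0 :: nat)"
    proof (intro sum.neutral ballI)
      fix bs assume "bs \<in> turn_words (Suc n) j"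
      then show "of_bool (opposite_steps bs = v) = (0 :: nat)"
        using True opposite_steps_le[of bs] by (auto simp: turn_words_def)
    qed
    then show ?thesis using True by (simp add: compositions_def)
  next
    case False
    then have v: "v \<le> n + 1" using Suc.prems by simp
    have T: "(\<Sum>bs\<in>turn_words n (j - 1). of_bool (opposite_steps (True # bs) = v)) =
        compositions ((j + 1) div 2) v * compositions (j div 2) (n + 1 - v)" if "j \<noteq> 0"
    proof -
      \<comment> \<open>After the turn, steps against the old velocity are steps along the new
        one.\<close>
      have "(\<Sum>bs\<in>turn_words n (j - 1). of_bool (opposite_steps (True # bs) = v)) =
          (\<Sum>bs\<in>turn_words n (j - 1). of_bool (opposite_steps bs = n + 1 - v) :: nat)"
      proof (intro sum.cong refl arg_cong[of _ _ of_bool])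
        fix bs assume "bs \<in> turn_words n (j - 1)"
        then show "(opposite_steps (True # bs) = v) = (opposite_steps bs = n + 1 - v)"
          using v opposite_steps_le[of bs] by (auto simp: turn_words_def)
      qed
      also have "\<dots> = compositions ((j - 1) div 2 + 1) (n + 1 - (n + 1 - v)) *
          compositions ((j - 1 + 1) div 2) (n + 1 - v)"
        by (rule Suc.IH) simp
      also have "(j - 1) div 2 + 1 = (j + 1) div 2" using that by presburger
      finally show ?thesis using v that by simp
    qed
    have "Suc n + 1 - v = Suc (n + 1 - v)" using v by simp
    moreover have "j = 0 \<Longrightarrow> v \<noteq> 0 \<Longrightarrow> compositions ((j + 1) div 2) v = 0"
      by (simp add: compositions_def)
    ultimately show ?thesis
      unfolding sum_turn_words_Suc opposite_steps.simps(2)[of False] if_False F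
      using T v
      by (cases "j = 0") (auto simp: compositions_Suc_Suc algebra_simps compositions_def[of 0])
  qed
qed

section \<open>Scaling limit\<close>

lemma tendsto_binomial_over_power:
  fixes a :: "nat \<Rightarrow> nat"
  assumes "(\<lambda>n. real (a n) / real n) \<longlonglongrightarrow> \<alpha>"
  shows "(\<lambda>n. real (a n choose k) / real n ^ k) \<longlonglongrightarrow> \<alpha> ^ k / fact k"
proof -
  have "(\<lambda>n. (real (a n) - real i) / real n) \<longlonglongrightarrow> \<alpha>" for i
    using tendsto_diff[OF assms lim_const_over_n[of "real i"]] by (simp add: diff_divide_distrib)
  then have "(\<lambda>n. (\<Prod>i\<in>{0..<k}. (real (a n) - real i) / real n) / fact k) \<longlonglongrightarrow> (\<Prod>i\<in>{0..<k}. \<alpha>) / fact k"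
    by (intro tendsto_intros) auto
  moreover have "real (a n choose k) / real n ^ k =
      (\<Prod>i\<in>{0..<k}. (real (a n) - real i) / real n) / fact k" for n
    by (simp add: binomial_gbinomial gbinomial_prod_rev prod_dividef)
  ultimately show ?thesis by simp
qed

text \<open>Riemann sums become exact integrals of step functions, so that their limits follow from
  dominated convergence.\<close>

lemma has_integral_floor_step:
  fixes \<phi> :: "nat \<Rightarrow> real"
  assumes "0 < n"
  shows "((\<lambda>s. \<phi> (nat \<lfloor>real n * s\<rfloor>)) has_integral (\<Sum>i<m. \<phi> i) / real n) {0..real m / real n}"
proof (induction m)
  case 0
  then show ?case by (simp add: has_integral_refl)
next
  case (Suc m)
  have "((\<lambda>s. \<phi> m) has_integral (real (Suc m) / real n - real m / real n) * \<phi> m)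
      {real m / real n..real (Suc m) / real n}"
    using has_integral_const_real[of "\<phi> m" "real m / real n" "real (Suc m) / real n"] assms
    by (simp add: divide_right_mono)
  then have "((\<lambda>s. \<phi> (nat \<lfloor>real n * s\<rfloor>)) has_integral (real (Suc m) / real n - real m / real n) * \<phi> m)
      {real m / real n..real (Suc m) / real n}"
  \<comment> \<open>Within the cell the floor changes only at the right end point.\<close>
  proof (rule has_integral_spike_finite[of "{real (Suc m) / real n}", rotated 2])
    fix s assume "s \<in> {real m / real n..real (Suc m) / real n} - {real (Suc m) / real n}"
    then have "real m \<le> real n * s" "real n * s < real m + 1"
      using assms by (auto simp: field_simps)
    then have "\<lfloor>real n * s\<rfloor> = int m" by (simp add: floor_eq_iff)
    then show "\<phi> (nat \<lfloor>real n * s\<rfloor>) = \<phi> m" by simp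
  qed simp
  from has_integral_combine[OF _ _ Suc this] assms show ?case
    by (simp add: divide_right_mono field_simps)
qed

lemma sum_turn_words_opposite_steps:
  fixes G :: "nat \<Rightarrow> real"
  shows "(\<Sum>bs\<in>turn_words n j. G (opposite_steps bs)) =
    (\<Sum>v\<le>n + 1. real (compositions (j div 2 + 1) (n + 1 - v) * compositions ((j + 1) div 2) v) * G v)"
proof -
  have "(\<Sum>bs\<in>turn_words n j. G (opposite_steps bs)) =
      (\<Sum>bs\<in>turn_words n j. \<Sum>v\<le>n + 1. of_bool (opposite_steps bs = v) * G v)"
  proof (intro sum.cong refl)
    fix bs assume "bs \<in> turn_words n j"
    then have "opposite_steps bs \<le> n + 1"
      using opposite_steps_le[of bs] by (auto simp: turn_words_def)
    then have "(\<Sum>v\<le>n + 1. of_bool (opposite_steps bs = v) * G v) =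
        (\<Sum>v\<in>{opposite_steps bs}. of_bool (opposite_steps bs = v) * G v)"
      by (intro sum.mono_neutral_right) auto
    then show "G (opposite_steps bs) = (\<Sum>v\<le>n + 1. of_bool (opposite_steps bs = v) * G v)" by simp
  qed
  also have "\<dots> = (\<Sum>v\<le>n + 1. real (\<Sum>bs\<in>turn_words n j. of_bool (opposite_steps bs = v)) * G v)"
    by (subst sum.swap) (simp add: sum_distrib_right)
  also have "\<dots> = (\<Sum>v\<le>n + 1.
      real (compositions (j div 2 + 1) (n + 1 - v) * compositions ((j + 1) div 2) v) * G v)"
    by (intro sum.cong refl arg_cong2[of _ _ _ _ "(*)"] arg_cong[of _ _ real] count_opposite_steps) auto
  finally show ?thesis .
qed

text \<open>With v up steps the walk ends at 2 v - n - 1. The binomials count the splittings of its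
  n + 1 - v down steps into k + 1 runs and of its up steps into k runs, where v = i + 1. Without
  turns the walk only descends and \<open>g\<close> vanishes.\<close>

lemma sum_walk_max_eq:
  fixes g :: "real \<Rightarrow> real"
  assumes g: "\<And>y. y \<le> 0 \<Longrightarrow> g y = 0" and "0 \<le> a"
  shows "(\<Sum>bs\<in>turn_words n (2 * k). g (a * real_of_int (walk_max (- 1) bs))) =
    (if k = 0 then 0 else
     (\<Sum>i<n. real ((n - 1 - i) choose k) * real (i choose (k - 1)) *
       (g (a * (2 * real i + 1 - real n)) + g (a * (2 * real i + 2 - real n)))))"
proof -
  define G where "G = (\<lambda>v::nat. g (a * (2 * real v - 1 - real n)) + g (a * (2 * real v - real n)))"
  have "(\<Sum>bs\<in>turn_words n (2 * k). g (a * real_of_int (walk_max (- 1) bs))) =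
      (\<Sum>bs\<in>turn_words n (2 * k). g (a * real_of_int (walk_end (- 1) bs)) +
        g (a * real_of_int (walk_end (- 1) bs + 1)))"
    by (rule sum_walk_max_eq_sum_walk_end[of "\<lambda>y. g (a * real_of_int y)"])
      (use assms in \<open>auto intro!: g mult_nonneg_nonpos\<close>)
  also have "\<dots> = (\<Sum>bs\<in>turn_words n (2 * k). G (opposite_steps bs))"
    by (intro sum.cong refl) (simp add: G_def walk_end_eq turn_words_def algebra_simps)
  also have "\<dots> = (\<Sum>v\<le>n + 1.
      real (compositions (k + 1) (n + 1 - v) * compositions k v) * G v)"
    by (subst sum_turn_words_opposite_steps) simp
  also have "\<dots> = (if k = 0 then 0 else
     (\<Sum>i<n. real ((n - 1 - i) choose k) * real (i choose (k - 1)) * G (Suc i)))"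
  proof (cases "k = 0")
    case True
    have "G 0 = 0" unfolding G_def using \<open>0 \<le> a\<close>
      by (simp add: g mult_nonneg_nonpos)
    then show ?thesis using True by (auto intro!: sum.neutral simp: compositions_def)
  next
    case False
    have "(\<Sum>v\<le>n + 1. real (compositions (k + 1) (n + 1 - v) * compositions k v) * G v) =
        (\<Sum>v\<in>Suc ` {..<n}. real (compositions (k + 1) (n + 1 - v) * compositions k v) * G v)"
    proof (rule sum.mono_neutral_right)
      show "\<forall>v\<in>{..n + 1} - Suc ` {..<n}.
          real (compositions (k + 1) (n + 1 - v) * compositions k v) * G v = 0"
      proof
        fix v assume v: "v \<in> {..n + 1} - Suc ` {..<n}"
        then have "v = 0 \<or> v = n + 1" by (cases v) auto
        then show "real (compositions (k + 1) (n + 1 - v) * compositions k v) * G v = 0"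
          using False by (auto simp: compositions_def)
      qed
    qed auto
    also have "\<dots> = (\<Sum>i<n. real ((n - 1 - i) choose k) * real (i choose (k - 1)) * G (Suc i))"
      using False by (subst sum.reindex) (auto intro!: sum.cong simp: compositions_def)
    finally show ?thesis using False by simp
  qed
  finally show ?thesis by (simp add: G_def algebra_simps)
qed

lemma binomial_over_power_le_1:
  assumes "a \<le> n"
  shows "real (a choose k) / real n ^ k \<le> 1"
proof (cases "n = 0")
  case True
  then show ?thesis using assms by (cases k) auto
next
  case False
  have "a choose k \<le> a ^ k"
    by (cases "k \<le> a") (auto simp: binomial_le_pow binomial_eq_0)
  also have "\<dots> \<le> n ^ k" using assms by (rule power_mono) simp
  finally have "real (a choose k) \<le> real n ^ k" by (metis of_nat_le_iff of_nat_power)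
  then show ?thesis using False by simp
qed

lemma tendsto_floor_over_n: "(\<lambda>n. real (nat \<lfloor>real n * s\<rfloor>) / real n) \<longlonglongrightarrow> s" if "0 \<le> s"
proof (rule real_tendsto_sandwich[of "\<lambda>n. s - 1 / real n" _ _ "\<lambda>n. s"])
  show "\<forall>\<^sub>F n in sequentially. s - 1 / real n \<le> real (nat \<lfloor>real n * s\<rfloor>) / real n"
    using eventually_gt_at_top[of 0]
  proof eventually_elim
    case (elim n)
    have "real n * s - 1 \<le> real (nat \<lfloor>real n * s\<rfloor>)" using that by linarith
    then have "(real n * s - 1) / real n \<le> real (nat \<lfloor>real n * s\<rfloor>) / real n"
      by (rule divide_right_mono) simp
    then show ?case using elim by (simp add: diff_divide_distrib)
  qed
  show "\<forall>\<^sub>F n in sequentially. real (nat \<lfloor>real n * s\<rfloor>) / real n \<le> s"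
    using eventually_gt_at_top[of 0]
  proof eventually_elim
    case (elim n)
    have "real (nat \<lfloor>real n * s\<rfloor>) \<le> real n * s" using that by simp
    then show ?case using elim by (simp add: field_simps)
  qed
  show "(\<lambda>n. s - 1 / real n) \<longlonglongrightarrow> s"
    using tendsto_diff[OF tendsto_const[of s] lim_const_over_n[of 1]] by simp
qed simp

text \<open>Of the 2 k + 2 factors 1 / n, the two binomials absorb k + 1 and k, and the last one is
  the mesh of a Riemann sum. The variable s is the limiting fraction of up steps, so the scaled end
  point is L (2 s - 1); both shifted values of \<open>g\<close> tend to the same limit, whence the
  factor 2.\<close>

lemma walk_max_limit:
  fixes g :: "real \<Rightarrow> real"
  assumes g: "\<And>y. y \<le> 0 \<Longrightarrow> g y = 0"
    and cont: "continuous_on UNIV g" and bnd: "\<And>y. \<bar>g y\<bar> \<le> B" and L: "0 \<le> L"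
  shows "(\<lambda>n. 1 / real n ^ (2 * Suc k) *
      (\<Sum>bs\<in>turn_words n (2 * Suc k). g (L / real n * real_of_int (walk_max (- 1) bs))))
    \<longlonglongrightarrow> integral {0..1} (\<lambda>s. (1 - s) ^ Suc k / fact (Suc k) * (s ^ k / fact k) *
        (2 * g (L * (2 * s - 1))))"
proof -
  define \<phi> where "\<phi> = (\<lambda>n i. real ((n - 1 - i) choose Suc k) / real n ^ Suc k *
      (real (i choose k) / real n ^ k) *
      (g (L / real n * (2 * real i + 1 - real n)) + g (L / real n * (2 * real i + 2 - real n))))"
  define f where "f = (\<lambda>n s. \<phi> n (nat \<lfloor>real n * s\<rfloor>))"
  let ?f = "\<lambda>s. (1 - s) ^ Suc k / fact (Suc k) * (s ^ k / fact k) * (2 * g (L * (2 * s - 1)))"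
  have I: "(f n has_integral 1 / real n ^ (2 * Suc k) *
      (\<Sum>bs\<in>turn_words n (2 * Suc k). g (L / real n * real_of_int (walk_max (- 1) bs)))) {0..1}"
    if "0 < n" for n
  proof -
    have "1 / real n ^ (2 * Suc k) *
        (\<Sum>bs\<in>turn_words n (2 * Suc k). g (L / real n * real_of_int (walk_max (- 1) bs))) =
        (\<Sum>i<n. \<phi> n i) / real n"
      using that L unfolding \<phi>_def
      by (subst sum_walk_max_eq) (auto simp: g sum_distrib_left sum_divide_distrib
          power_mult power2_eq_square power_mult_distrib intro!: sum.cong)
    moreover have "(f n has_integral (\<Sum>i<n. \<phi> n i) / real n) {0..real n / real n}"
      unfolding f_def by (rule has_integral_floor_step[OF that])
    ultimately show ?thesis using that by simp
  qed
  \<comment> \<open>The bound 2 B below comes from two values of \<open>g\<close>, each weighted by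
    normalized binomials that are at most 1.\<close>
  have "(\<lambda>n. integral {0..1} (f (Suc n))) \<longlonglongrightarrow> integral {0..1} ?f"
  proof (rule dominated_convergence(2)[where h = "\<lambda>_. 2 * B"])
    show "f (Suc n) integrable_on {0..1}" for n using I[of "Suc n"] by (auto simp: integrable_on_def)
    show "(\<lambda>_. 2 * B) integrable_on {0..1::real}" by (rule integrable_const_ivl)
    show "norm (f (Suc n) s) \<le> 2 * B" if "s \<in> {0..1}" for n s
    proof -
      let ?i = "nat \<lfloor>real (Suc n) * s\<rfloor>"
      have "real (Suc n) * s \<le> real (Suc n)" using that by (intro mult_left_le) auto
      then have i: "?i \<le> Suc n" by linarith
      have *: "\<bar>x * y * (z + w)\<bar> \<le> 2 * B" if "\<bar>x\<bar> \<le> 1" "\<bar>y\<bar> \<le> 1" "\<bar>z\<bar> \<le> B" "\<bar>w\<bar> \<le> B" for x y z w :: real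
      proof -
        have "\<bar>x * y\<bar> \<le> 1" using that by (simp add: abs_mult mult_le_one)
        moreover have "\<bar>z + w\<bar> \<le> 2 * B" using that by linarith
        ultimately have "\<bar>x * y\<bar> * \<bar>z + w\<bar> \<le> 1 * (2 * B)" by (intro mult_mono) auto
        then show ?thesis by (simp add: abs_mult)
      qed
      show ?thesis unfolding f_def \<phi>_def real_norm_def
        using binomial_over_power_le_1[of "Suc n - 1 - ?i" "Suc n" "Suc k"]
          binomial_over_power_le_1[OF i, of k]
        by (intro * bnd) auto
    qed
    show "(\<lambda>n. f (Suc n) s) \<longlonglongrightarrow> ?f s" if s: "s \<in> {0..1}" for s
    proof -
      let ?i = "\<lambda>n. nat \<lfloor>real n * s\<rfloor>"
      have i: "(\<lambda>n. real (?i n) / real n) \<longlonglongrightarrow> s" using s by (intro tendsto_floor_over_n) simp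
      have ile: "?i n \<le> n" for n
      proof -
        have "real n * s \<le> real n" using s by (intro mult_left_le) auto
        then show ?thesis by linarith
      qed
      have "(\<lambda>n. real (n - ?i n) / real n) \<longlonglongrightarrow> 1 - s"
      proof (rule Lim_transform_eventually[OF tendsto_diff[OF tendsto_const[of 1] i]])
        show "\<forall>\<^sub>F n in sequentially. 1 - real (?i n) / real n = real (n - ?i n) / real n"
          using eventually_gt_at_top[of 0]
          by eventually_elim (use ile in \<open>auto simp: of_nat_diff field_simps\<close>)
      qed
      then have "(\<lambda>n. real (n - 1 - ?i n) / real n) \<longlonglongrightarrow> 1 - s"
      proof (rule tendsto_sandwich[OF _ _ tendsto_diff[OF _ lim_const_over_n[of 1], simplified], rotated 2])
        show "(\<lambda>n. real (n - ?i n) / real n) \<longlonglongrightarrow> 1 - s" by fact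
        show "\<forall>\<^sub>F n in sequentially. real (n - ?i n) / real n - 1 / real n \<le> real (n - 1 - ?i n) / real n"
          unfolding diff_divide_distrib[symmetric]
          by (intro always_eventually allI divide_right_mono) linarith+
        show "\<forall>\<^sub>F n in sequentially. real (n - 1 - ?i n) / real n \<le> real (n - ?i n) / real n"
          by (intro always_eventually allI divide_right_mono) auto
      qed
      note c1 = tendsto_binomial_over_power[OF this, of "Suc k"]
      note c2 = tendsto_binomial_over_power[OF i, of k]
      have gg: "(\<lambda>n. g (L / real n * (2 * real (?i n) + b - real n))) \<longlonglongrightarrow> g (L * (2 * s - 1))" for b
      proof (rule continuous_on_tendsto_compose[OF cont])
        have "(\<lambda>n. L * (2 * (real (?i n) / real n) + b / real n - 1)) \<longlonglongrightarrow> L * (2 * s + 0 - 1)"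
          by (intro tendsto_mult tendsto_diff tendsto_add tendsto_const i lim_const_over_n)
        then have "(\<lambda>n. L * (2 * (real (?i n) / real n) + b / real n - 1)) \<longlonglongrightarrow> L * (2 * s - 1)"
          by simp
        then show "(\<lambda>n. L / real n * (2 * real (?i n) + b - real n)) \<longlonglongrightarrow> L * (2 * s - 1)"
        proof (rule Lim_transform_eventually)
          show "\<forall>\<^sub>F n in sequentially. L * (2 * (real (?i n) / real n) + b / real n - 1) =
              L / real n * (2 * real (?i n) + b - real n)"
            using eventually_gt_at_top[of 0] by eventually_elim (simp add: field_simps)
        qed
      qed auto
      have "(\<lambda>n. f n s) \<longlonglongrightarrow> (1 - s) ^ Suc k / fact (Suc k) * (s ^ k / fact k) *
          (g (L * (2 * s - 1)) + g (L * (2 * s - 1)))"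
        unfolding f_def \<phi>_def by (intro tendsto_mult tendsto_add c1 c2 gg)
      from LIMSEQ_Suc[OF this] show ?thesis by (simp only: mult_2)
    qed
  qed
  moreover have "integral {0..1} (f (Suc n)) = 1 / real (Suc n) ^ (2 * Suc k) *
      (\<Sum>bs\<in>turn_words (Suc n) (2 * Suc k). g (L / real (Suc n) * real_of_int (walk_max (- 1) bs)))" for n
    by (rule integral_unique[OF I]) simp
  ultimately show ?thesis by (subst filterlim_sequentially_Suc[symmetric]) simp
qed

section \<open>The limit density of the maximum\<close>

text \<open>\<open>max_density k\<close> belongs to \<open>2 * Suc k\<close> jumps.\<close>

definition max_density :: "nat \<Rightarrow> real \<Rightarrow> real" where
  "max_density k x = fact (2 * Suc k) / (fact (Suc k) * fact k * 2 ^ (2 * k + 1)) *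
     ((1 - x) * (1 - x\<^sup>2) ^ k)"

lemma continuous_on_max_density: "continuous_on A (max_density k)"
  unfolding max_density_def by (intro continuous_intros)

text \<open>The number of words is asymptotically n^(2 k + 2) / (2 k + 2)!, which explains the
  normalization. Substituting x = 2 s - 1 turns 1 - s and s into (1 - x) / 2 and (1 + x) / 2, and dx
  = 2 ds absorbs the factor 2; the half s \<le> 1 / 2 drops out because \<open>g\<close> vanishes
  there.\<close>

lemma walk_max_limit_density:
  fixes g :: "real \<Rightarrow> real"
  assumes g: "\<And>y. y \<le> 0 \<Longrightarrow> g y = 0"
    and cont: "continuous_on UNIV g" and bnd: "\<And>y. \<bar>g y\<bar> \<le> B" and L: "0 \<le> L"
  shows "(\<lambda>n. fact (2 * Suc k) / real n ^ (2 * Suc k) *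
      (\<Sum>bs\<in>turn_words n (2 * Suc k). g (L / real n * real_of_int (walk_max (- 1) bs))))
    \<longlonglongrightarrow> integral {0..1} (\<lambda>x. max_density k x * g (L * x))"
proof -
  let ?h = "\<lambda>x. max_density k x * g (L * x)"
  let ?H = "\<lambda>s. (1 - s) ^ Suc k / fact (Suc k) * (s ^ k / fact k) * (2 * g (L * (2 * s - 1)))"
  have "continuous_on {0..1} ?h"
    by (intro continuous_intros continuous_on_max_density continuous_on_compose2[OF cont]) auto
  then have "(?h has_integral integral {0..1} ?h) (cbox 0 1)"
    by (simp add: integrable_integral integrable_continuous_real)
  from has_integral_affinity[OF this, of 2 "-1"]
  have "((\<lambda>s. ?h (2 * s - 1)) has_integral integral {0..1} ?h / 2)
      ((\<lambda>x. (1 / 2) *\<^sub>R x + - ((1 / 2) *\<^sub>R - 1)) ` {0..1})" by simp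
  also have "(\<lambda>x. (1 / 2) *\<^sub>R x + - ((1 / 2) *\<^sub>R - 1)) ` {0..1} = {1 / 2..1::real}"
    using image_affinity_atLeastAtMost[of "1/2" "1/2" 0 "1::real"] by (simp add: algebra_simps)
  finally have upper: "((\<lambda>s. ?h (2 * s - 1)) has_integral integral {0..1} ?h / 2) {1 / 2..1}" .
  have lower: "((\<lambda>s. ?h (2 * s - 1)) has_integral 0) {0..1 / 2}"
    by (rule has_integral_is_0) (use L in \<open>auto simp: g mult_nonneg_nonpos\<close>)
  have "((\<lambda>s. ?h (2 * s - 1)) has_integral 0 + integral {0..1} ?h / 2) {0..1}"
    by (rule has_integral_combine[OF _ _ lower upper]) auto
  from has_integral_mult_right[OF this, of 2]
  have "((\<lambda>s. 2 * ?h (2 * s - 1)) has_integral integral {0..1} ?h) {0..1}" by simp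
  moreover have "2 * ?h (2 * s - 1) = fact (2 * Suc k) * ?H s" for s
  proof -
    have "1 - (2 * s - 1)\<^sup>2 = 4 * (s * (1 - s))" by (simp add: power2_eq_square algebra_simps)
    then have "max_density k (2 * s - 1) = fact (2 * Suc k) / (fact (Suc k) * fact k * 2 ^ (2 * k + 1)) *
        ((2 * (1 - s)) * (4 * (s * (1 - s))) ^ k)"
      by (simp add: max_density_def)
    also have "((2 * (1 - s)) * (4 * (s * (1 - s))) ^ k) = 2 ^ (2 * k + 1) * ((1 - s) ^ Suc k * s ^ k)"
      by (simp add: power_mult_distrib power_mult)
    finally show ?thesis by (simp del: fact_Suc)
  qed
  ultimately have "((\<lambda>s. fact (2 * Suc k) * ?H s) has_integral integral {0..1} ?h) {0..1}" by simp
  then have "integral {0..1} (\<lambda>s. fact (2 * Suc k) * ?H s) = integral {0..1} ?h"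
    by (rule integral_unique)
  then have eq: "fact (2 * Suc k) * integral {0..1} ?H = integral {0..1} ?h"
    by (subst (asm) integral_mult_right)
  have "(\<lambda>n. fact (2 * Suc k) * (1 / real n ^ (2 * Suc k) *
      (\<Sum>bs\<in>turn_words n (2 * Suc k). g (L / real n * real_of_int (walk_max (- 1) bs)))))
    \<longlonglongrightarrow> fact (2 * Suc k) * integral {0..1} ?H"
    by (intro tendsto_mult tendsto_const walk_max_limit[OF assms])
  then show ?thesis unfolding eq by (simp only: mult.assoc[symmetric] times_divide_eq_right mult_1_right)
qed

section \<open>Beta integrals and Gamma quotients\<close>

lemma Gamma_plus1_pos: "0 < x \<Longrightarrow> Gamma (x + 1) = x * Gamma (x :: real)"
  by (rule Gamma_plus1) (auto elim!: nonpos_Ints_cases)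

text \<open>Half of the Beta integral B((m + 1) / 2, k + 1). Splitting off one factor 1 - x^2
  reduces k + 1 to k with the exponents m and m + 2, so \<open>m\<close> must vary in the
  induction.\<close>

lemma has_integral_power_times_one_minus_square:
  "((\<lambda>x. x ^ m * (1 - x\<^sup>2) ^ k) has_integral
     Gamma ((real m + 1) / 2) * fact k / (2 * Gamma (real (Suc k) + (real m + 1) / 2))) {0..1}"
proof (induction k arbitrary: m)
  case 0
  have has: "((\<lambda>x. x ^ m) has_integral (1 ^ Suc m / real (Suc m) - 0 ^ Suc m / real (Suc m))) {0..1::real}"
  proof (rule fundamental_theorem_of_calculus)
    fix x :: real
    have "((\<lambda>x. x ^ Suc m / real (Suc m)) has_real_derivative
        real (Suc m) * x ^ (Suc m - Suc 0) / real (Suc m)) (at x within {0..1})"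
      using DERIV_cdivide[OF DERIV_pow[of "Suc m" x "{0..1}"], of "real (Suc m)"] by simp
    then show "((\<lambda>x. x ^ Suc m / real (Suc m)) has_vector_derivative x ^ m) (at x within {0..1})"
      unfolding has_real_derivative_iff_has_vector_derivative[symmetric] by (simp del: power_Suc of_nat_Suc)
  qed simp
  define a where "a = (real m + 1) / 2"
  have "Gamma (real (Suc 0) + a) = a * Gamma a"
    using Gamma_plus1_pos[of a] by (simp add: a_def add.commute)
  moreover have "0 < Gamma a" by (simp add: a_def)
  ultimately have "Gamma a * fact 0 / (2 * Gamma (real (Suc 0) + a)) = 1 / (2 * a)" by simp
  also have "\<dots> = 1 ^ Suc m / real (Suc m) - 0 ^ Suc m / real (Suc m)"
    by (simp add: a_def divide_simps)
  finally have "Gamma ((real m + 1) / 2) * fact 0 / (2 * Gamma (real (Suc 0) + (real m + 1) / 2)) =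
      1 ^ Suc m / real (Suc m) - 0 ^ Suc m / real (Suc m)"
    unfolding a_def .
  then show ?case using has by simp
next
  case (Suc k)
  define a where "a = (real m + 1) / 2"
  have a: "a > 0" by (simp add: a_def)
  have a2: "(real (m + 2) + 1) / 2 = a + 1" by (simp add: a_def add_divide_distrib)
  have "((\<lambda>x. x ^ m * (1 - x\<^sup>2) ^ k - x ^ (m + 2) * (1 - x\<^sup>2) ^ k) has_integral
     Gamma a * fact k / (2 * Gamma (real (Suc k) + a)) -
     Gamma (a + 1) * fact k / (2 * Gamma (real (Suc k) + (a + 1)))) {0..1}"
    using has_integral_diff[OF Suc[of m] Suc[of "m + 2"]] unfolding a2 a_def[symmetric] .
  moreover have "Gamma a * fact k / (2 * Gamma (real (Suc k) + a)) -
     Gamma (a + 1) * fact k / (2 * Gamma (real (Suc k) + (a + 1))) =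
     Gamma a * fact (Suc k) / (2 * Gamma (real (Suc (Suc k)) + a))" (is "?L = ?R")
  proof -
    have 1: "Gamma (a + 1) = a * Gamma a" using a by (rule Gamma_plus1_pos)
    have 2: "Gamma (real (Suc k) + a + 1) = (real (Suc k) + a) * Gamma (real (Suc k) + a)"
      using a by (intro Gamma_plus1_pos) simp
    have 3: "Gamma (real (Suc k) + a) > 0" "real (Suc k) + a > 0" using a by auto
    have "real (Suc k) + (a + 1) = real (Suc k) + a + 1" "real (Suc (Suc k)) + a = real (Suc k) + a + 1"
      by simp_all
    then have "?L = Gamma a * fact k / (2 * Gamma (real (Suc k) + a)) -
        a * Gamma a * fact k / (2 * ((real (Suc k) + a) * Gamma (real (Suc k) + a)))"
      and "?R = Gamma a * (real (Suc k) * fact k) / (2 * ((real (Suc k) + a) * Gamma (real (Suc k) + a)))"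
      by (simp_all only: 1 2 fact_Suc)
    moreover have "G * f / (2 * H) - a * G * f / (2 * (b * H)) = G * ((b - a) * f) / (2 * (b * H))"
      if "b > 0" "H > 0" for G f H b :: real
      using that by (simp add: field_simps)
    from this[OF 3(2,1)] have "Gamma a * fact k / (2 * Gamma (real (Suc k) + a)) -
        a * Gamma a * fact k / (2 * ((real (Suc k) + a) * Gamma (real (Suc k) + a))) =
        Gamma a * (real (Suc k) * fact k) / (2 * ((real (Suc k) + a) * Gamma (real (Suc k) + a)))"
      by (simp only: add_diff_cancel_right')
    ultimately show ?thesis by (simp only:)
  qed
  moreover have "x ^ m * (1 - x\<^sup>2) ^ k - x ^ (m + 2) * (1 - x\<^sup>2) ^ k = x ^ m * (1 - x\<^sup>2) ^ Suc k"
    for x :: real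
    by (simp add: power_add power2_eq_square right_diff_distrib left_diff_distrib mult.assoc)
  ultimately show ?case unfolding a_def[symmetric] by (simp only:)
qed

text \<open>Multiplying out the factor 1 - x leaves a difference of two Beta integrals, with
  exponents m and m + 1; each yields one Gamma quotient.\<close>

lemma has_integral_max_density_power:
  "((\<lambda>x. max_density k x * x ^ m) has_integral
     fact (2 * Suc k) / (2 ^ (2 * Suc k) * fact (Suc k)) *
       (Gamma ((real m + 1) / 2) / Gamma (real (Suc k) + (real m + 1) / 2)
        - Gamma (real m / 2 + 1) / Gamma (real (Suc k) + 1 + real m / 2))) {0..1}"
proof -
  let ?C = "fact (2 * Suc k) / (fact (Suc k) * fact k * 2 ^ (2 * k + 1)) :: real"
  have 1: "max_density k x * x ^ m =
      ?C * (x ^ m * (1 - x\<^sup>2) ^ k - x ^ (m + 1) * (1 - x\<^sup>2) ^ k)" for x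
  proof -
    have "C * ((1 - x) * q) * p = C * (p * q - (x * p) * q)" for C p q :: real
      by (simp add: algebra_simps)
    then show ?thesis unfolding max_density_def by (simp only: Suc_eq_plus1[symmetric] power_Suc)
  qed
  have 2: "(real (m + 1) + 1) / 2 = real m / 2 + 1" by (simp add: field_simps)
  have 4: "real (Suc k) + (real m / 2 + 1) = real (Suc k) + 1 + real m / 2" by simp
  have distr: "C * (A * f / (2 * B) - A' * f / (2 * B')) = (C * (f / 2)) * (A / B - A' / B')"
    for A B A' B' C f :: real
    by (simp add: right_diff_distrib mult.assoc mult.left_commute[of f] mult.commute[of f])
  have 3: "fact (2 * Suc k) / (2 ^ (2 * Suc k) * fact (Suc k)) * (A / B - A' / B') =
      ?C * (A * fact k / (2 * B) - A' * fact k / (2 * B'))" for A B A' B' :: real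
  proof -
    have "?C * (A * fact k / (2 * B) - A' * fact k / (2 * B')) = (?C * (fact k / 2)) * (A / B - A' / B')"
      by (rule distr)
    also have "?C * (fact k / 2) = fact (2 * Suc k) / (2 ^ (2 * Suc k) * fact (Suc k))"
      by (simp del: fact_Suc)
    finally show ?thesis by simp
  qed
  show ?thesis
    unfolding 1 3
    using has_integral_mult_right[OF has_integral_diff[OF
      has_integral_power_times_one_minus_square[of m k]
      has_integral_power_times_one_minus_square[of "m + 1" k]], of ?C]
    unfolding 2 4 .
qed

text \<open>Kept in terms of Gamma(1/2), which cancels in the quotients, rather than the square root
  of pi.\<close>

lemma Gamma_nat_plus_half:
  "Gamma (real n + 1 / 2) = fact (2 * n) / (4 ^ n * fact n) * Gamma (1 / 2)"
proof (induction n)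
  case (Suc n)
  have "Gamma (real (Suc n) + 1 / 2) = Gamma (real n + 1 / 2 + 1)" by (simp add: algebra_simps)
  also have "\<dots> = (real n + 1 / 2) * Gamma (real n + 1 / 2)"
    by (rule Gamma_plus1_pos) simp
  also have "\<dots> = (real n + 1 / 2) * (fact (2 * n) / (4 ^ n * fact n)) * Gamma (1 / 2)"
    by (simp only: Suc mult.assoc)
  also have "(real n + 1 / 2) * (fact (2 * n) / (4 ^ n * fact n)) =
      fact (2 * Suc n) / (4 ^ Suc n * fact (Suc n))"
    by (simp add: divide_simps) (simp add: algebra_simps)
  finally show ?case .
qed simp

text \<open>The moment of order 0 is the mass of the density: the first quotient contributes 1, and
  the second, through Gamma(1) / Gamma(k + 1) = 1 / k!, the weight of the atom at 0.\<close>

lemma moment_formula_0: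
  "fact (2 * k) / (2 ^ (2 * k) * fact k) *
     (Gamma ((real 0 + 1) / 2) / Gamma (real k + (real 0 + 1) / 2)
      - Gamma (real 0 / 2 + 1) / Gamma (real k + 1 + real 0 / 2)) =
   1 - fact (2 * k) / ((fact k)\<^sup>2 * 2 ^ (2 * k))"
proof -
  have "Gamma (real k + 1) = fact k" using Gamma_fact[of k, where 'a = real] by (simp add: add.commute)
  moreover have "Gamma (1 / 2 :: real) \<noteq> 0" by (simp add: Gamma_one_half_real)
  ultimately have "Gamma (1 / 2) / Gamma (real k + 1 / 2) = 4 ^ k * fact k / fact (2 * k)"
      "Gamma 1 / Gamma (real k + 1) = 1 / fact k"
    by (simp_all add: Gamma_nat_plus_half)
  then show ?thesis by (simp add: right_diff_distrib power_mult power2_eq_square)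
qed

text \<open>The quotient Gamma(1) / Gamma(k + 1), subtracted at order 0, is the leading term at
  order 1; this is why the mean contains the probability of the atom.\<close>

lemma moment_formula_1:
  "fact (2 * k) / (2 ^ (2 * k) * fact k) *
     (Gamma ((real 1 + 1) / 2) / Gamma (real k + (real 1 + 1) / 2)
      - Gamma (real 1 / 2 + 1) / Gamma (real k + 1 + real 1 / 2)) =
   fact (2 * k) / ((fact k)\<^sup>2 * 2 ^ (2 * k)) - 1 / (2 * real k + 1)"
proof -
  have 1: "Gamma (real k + 1) = fact k" using Gamma_fact[of k, where 'a = real] by (simp add: add.commute)
  have 2: "Gamma (1 / 2 + 1 :: real) = 1 / 2 * Gamma (1 / 2)"
    by (rule Gamma_plus1_pos) simp
  have 3: "Gamma (real k + 1 + 1 / 2) = fact (2 * Suc k) / (4 ^ Suc k * fact (Suc k)) * Gamma (1 / 2)"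
    using Gamma_nat_plus_half[of "Suc k"] by (simp add: algebra_simps)
  have 4: "fact (2 * Suc k) / fact (Suc k) = 2 * (2 * real k + 1) * (fact (2 * k) / fact k)"
    by (simp add: divide_simps) (simp add: algebra_simps)
  have "Gamma (1 / 2 :: real) \<noteq> 0" by (simp add: Gamma_one_half_real)
  then have 5: "Gamma (1 / 2 + 1 :: real) / Gamma (real k + 1 + 1 / 2) =
      4 ^ k * fact k / fact (2 * k) / (2 * real k + 1)"
    unfolding 2 3 using 4 by (simp add: divide_simps)
  show ?thesis
    using 1 5 by (simp add: right_diff_distrib power_mult power2_eq_square)
qed

section \<open>Discretization of a path\<close>

lemma path_set_integrable:
  fixes p :: "real \<Rightarrow> nat"
  assumes mono: "mono_on {0..} p" and "0 \<le> a"
  shows "set_integrable lborel {a..b} (\<lambda>u. v * (- 1) ^ p u :: real)"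
proof -
  \<comment> \<open>Freezing the path on the negative axis makes it monotone on the whole line,
    hence Borel.\<close>
  let ?q = "\<lambda>u. real (p (max 0 u))"
  have "mono ?q" by (rule monoI) (auto intro!: mono_onD[OF mono])
  then have [measurable]: "?q \<in> borel_measurable lborel"
    using borel_measurable_mono by auto
  \<comment> \<open>At integers the sign is cos(n pi), a continuous function of the real-valued
    path.\<close>
  have "set_integrable lborel {a..b} (\<lambda>u. v * cos (?q u * pi))"
    unfolding set_integrable_def
  proof (rule integrableI_bounded_set_indicator[where B = "\<bar>v\<bar>"])
    show "(\<lambda>u. v * cos (?q u * pi)) \<in> borel_measurable lborel" by measurable
    show "AE x in lborel. x \<in> {a..b} \<longrightarrow> norm (v * cos (?q x * pi)) \<le> \<bar>v\<bar>"
      by (auto simp: abs_mult intro!: mult_left_le)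
  qed (auto simp: emeasure_lborel_Icc_eq)
  moreover have "set_integrable lborel {a..b} (\<lambda>u. v * cos (?q u * pi)) =
      set_integrable lborel {a..b} (\<lambda>u. v * (- 1) ^ p u)"
    using \<open>0 \<le> a\<close> by (intro set_integrable_cong) (auto simp: max_def)
  ultimately show ?thesis by simp
qed

locale telegraph_path =
  fixes p :: "real \<Rightarrow> nat" and v :: real
  assumes mono: "mono_on {0..} p" and zero: "p 0 = 0"
begin

definition position :: "real \<Rightarrow> real" where
  "position s = (LINT u:{0..s}|lborel. v * (- 1) ^ p u)"

definition grid_position :: "real \<Rightarrow> nat \<Rightarrow> real" where
  "grid_position h i = h * (\<Sum>j<i. v * (- 1) ^ p (real j * h))"

lemma integrable_on: "0 \<le> a \<Longrightarrow> (\<lambda>u. v * (- 1) ^ p u) integrable_on {a..b}"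
  by (rule set_borel_integral_eq_integral(1)[OF path_set_integrable[OF mono]])

lemma position_eq: "position s = integral {0..s} (\<lambda>u. v * (- 1) ^ p u)"
  unfolding position_def by (rule set_borel_integral_eq_integral(2)[OF path_set_integrable[OF mono]]) simp

lemma position_diff:
  "0 \<le> a \<Longrightarrow> a \<le> b \<Longrightarrow> position b - position a = integral {a..b} (\<lambda>u. v * (- 1) ^ p u)"
  unfolding position_eq
  using Henstock_Kurzweil_Integration.integral_combine[of 0 a b "\<lambda>u. v * (- 1) ^ p u"] integrable_on[of 0 b] by simp

lemma position_0 [simp]: "position 0 = 0"
  by (simp add: position_eq)

lemma position_lipschitz:
  assumes "0 \<le> a" "a \<le> b"
  shows "\<bar>position b - position a\<bar> \<le> \<bar>v\<bar> * (b - a)"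
proof -
  have "norm (integral {a..b} (\<lambda>u. v * (- 1) ^ p u)) \<le> \<bar>v\<bar> * measure lborel {a..b}"
    by (rule has_integral_bound_real[OF _ _ integrable_integral[OF integrable_on[OF assms(1)]], where S = "{}"])
      (auto simp: abs_mult power_abs)
  then show ?thesis unfolding position_diff[OF assms] using assms by simp
qed

lemma continuous_on_position: "continuous_on {0..b} position"
proof (rule continuous_onI)
  fix x e :: real assume x: "x \<in> {0..b}" and e: "0 < e"
  show "\<exists>d>0. \<forall>x'\<in>{0..b}. dist x' x < d \<longrightarrow> dist (position x') (position x) \<le> e"
  proof (intro exI[of _ "e / (\<bar>v\<bar> + 1)"] conjI ballI impI)
    show "0 < e / (\<bar>v\<bar> + 1)" using e by simp
    fix y assume y: "y \<in> {0..b}" "dist y x < e / (\<bar>v\<bar> + 1)"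
    have "dist (position y) (position x) \<le> \<bar>v\<bar> * dist y x"
      using position_lipschitz[of x y] position_lipschitz[of y x] x y
      by (cases "x \<le> y") (auto simp: dist_real_def abs_minus_commute)
    also have "\<dots> \<le> (\<bar>v\<bar> + 1) * dist y x" by (simp add: mult_right_mono)
    also have "\<dots> \<le> e" using y e by (simp add: pos_less_divide_eq mult.commute)
    finally show "dist (position y) (position x) \<le> e" .
  qed
qed

text \<open>A cell without jumps contributes no error; any other cell contributes at most 2 |v| h,
  which is paid for by the increase of \<open>p\<close> by at least 1.\<close>

lemma grid_error:
  assumes "0 \<le> h"
  shows "\<bar>position (real i * h) - grid_position h i\<bar> \<le> 2 * \<bar>v\<bar> * h * real (p (real i * h))"
proof (induction i)
  case 0
  then show ?case by (simp add: grid_position_def zero)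
next
  case (Suc i)
  let ?a = "real i * h" and ?b = "real (Suc i) * h"
  have ab: "0 \<le> ?a" "?a \<le> ?b" "?b - ?a = h" using assms by (auto simp: algebra_simps)
  have le: "p ?a \<le> p ?b" using ab by (intro mono_onD[OF mono]) auto
  have step: "\<bar>position ?b - position ?a - h * (v * (- 1) ^ p ?a)\<bar> \<le>
      2 * \<bar>v\<bar> * h * (real (p ?b) - real (p ?a))"
  proof (cases "p ?a = p ?b")
    case True
    have const: "p u = p ?a" if "u \<in> {?a..?b}" for u
    proof -
      have "0 \<le> u" "?a \<le> u" "u \<le> ?b" using that ab(1) by (auto simp del: of_nat_Suc)
      then have "p ?a \<le> p u" "p u \<le> p ?b" using ab(1) by (auto intro!: mono_onD[OF mono] simp del: of_nat_Suc)
      then show ?thesis using True by simp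
    qed
    have "integral {?a..?b} (\<lambda>u. v * (- 1) ^ p u) = integral {?a..?b} (\<lambda>u. v * (- 1) ^ p ?a)"
      by (intro integral_cong) (simp only: const)
    then show ?thesis using position_diff[OF ab(1,2)] ab True by simp
  next
    case False
    then have "1 \<le> real (p ?b) - real (p ?a)" using le by linarith
    then have "2 * \<bar>v\<bar> * h * 1 \<le> 2 * \<bar>v\<bar> * h * (real (p ?b) - real (p ?a))"
      using assms by (intro mult_left_mono) auto
    moreover have "\<bar>h * (v * (- 1) ^ p ?a)\<bar> = \<bar>v\<bar> * h" using assms by (simp add: abs_mult power_abs)
    ultimately show ?thesis using position_lipschitz[OF ab(1,2)] ab by auto
  qed
  have "grid_position h (Suc i) = grid_position h i + h * (v * (- 1) ^ p ?a)"
    by (simp add: grid_position_def distrib_left)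
  then show ?case using Suc step by (simp only: right_diff_distrib)
qed

definition path_max :: "real \<Rightarrow> real" where
  "path_max t = (GREATEST y. y \<in> position ` {0..t})"

definition grid_max :: "real \<Rightarrow> nat \<Rightarrow> real" where
  "grid_max t n = Max (grid_position (t / real n) ` {..n})"

text \<open>Positions are continuous on a compact interval, so \<open>GREATEST\<close> denotes a
  genuine maximum.\<close>

lemma path_max_attained:
  assumes "0 \<le> t"
  obtains s where "s \<in> {0..t}" "path_max t = position s" "\<And>r. r \<in> {0..t} \<Longrightarrow> position r \<le> path_max t"
proof -
  obtain s where s: "s \<in> {0..t}" "\<And>r. r \<in> {0..t} \<Longrightarrow> position r \<le> position s"
    using continuous_attains_sup[of "{0..t}" position] continuous_on_position assms by auto
  have "path_max t = position s"
    unfolding path_max_def using s by (intro Greatest_equality) auto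
  with s show thesis by (intro that) auto
qed

text \<open>There are two sources of error: a maximizer lies within h of a grid point, which costs
  |v| h by the Lipschitz bound, and the walk deviates from the path by at most 2 |v| h per jump
  before time t.\<close>

lemma grid_max_error:
  assumes "0 \<le> t" "0 < n"
  shows "\<bar>path_max t - grid_max t n\<bar> \<le> (\<bar>v\<bar> + 2 * \<bar>v\<bar> * real (p t)) * (t / real n)"
proof -
  define h where "h = t / real n"
  have h: "0 \<le> h" "real n * h = t" using assms by (auto simp: h_def)
  have err: "\<bar>position (real i * h) - grid_position h i\<bar> \<le> 2 * \<bar>v\<bar> * real (p t) * h" if "i \<le> n" for i
  proof -
    have ih: "real i * h \<le> t" using that h by (metis mult_right_mono of_nat_le_iff)
    have "p (real i * h) \<le> p t" using ih h by (intro mono_onD[OF mono]) auto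
    then have "2 * \<bar>v\<bar> * h * real (p (real i * h)) \<le> 2 * \<bar>v\<bar> * h * real (p t)"
      using h by (intro mult_left_mono) auto
    then show ?thesis using grid_error[OF h(1), of i] by (simp only: mult_ac)
  qed
  obtain s where s: "s \<in> {0..t}" "path_max t = position s"
    "\<And>r. r \<in> {0..t} \<Longrightarrow> position r \<le> path_max t"
    using path_max_attained[OF assms(1)] by blast
  have fin: "finite (grid_position h ` {..n})" "grid_position h ` {..n} \<noteq> {}" by auto
  have "grid_max t n \<in> grid_position h ` {..n}" unfolding grid_max_def h_def[symmetric] by (rule Max_in[OF fin])
  then obtain i where i: "i \<le> n" "grid_max t n = grid_position h i" by auto
  have "real i * h \<le> real n * h" using i(1) h(1) by (intro mult_right_mono) auto
  then have "real i * h \<in> {0..t}" using h by simp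
  then have upper: "grid_max t n \<le> path_max t + 2 * \<bar>v\<bar> * real (p t) * h"
    using s(3)[of "real i * h"] err[OF i(1)] i(2) by linarith
  have lower: "path_max t \<le> grid_max t n + \<bar>v\<bar> * h + 2 * \<bar>v\<bar> * real (p t) * h"
  proof -
    obtain j where j: "j \<le> n" "real j * h \<le> s" "s - real j * h \<le> h"
    \<comment> \<open>Mesh 0 occurs for t = 0, where \<open>s / h\<close> would not give an
      index.\<close>
    proof (cases "h = 0")
      case True
      then show thesis using that[of 0] s h by auto
    next
      case False
      then have "h > 0" using h by simp
      let ?j = "nat \<lfloor>s / h\<rfloor>"
      have "0 \<le> s / h" "s / h \<le> real n" using s h \<open>h > 0\<close> by (auto simp: field_simps)
      then have "?j \<le> n" "real ?j \<le> s / h" "s / h \<le> real ?j + 1" by linarith+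
      then show thesis using that[of ?j] \<open>h > 0\<close> by (auto simp: field_simps)
    qed
    have "\<bar>position s - position (real j * h)\<bar> \<le> \<bar>v\<bar> * (s - real j * h)"
      using j h by (intro position_lipschitz) auto
    also have "\<dots> \<le> \<bar>v\<bar> * h" using j by (intro mult_left_mono) auto
    finally have "position s \<le> position (real j * h) + \<bar>v\<bar> * h" by linarith
    moreover have "grid_position h j \<le> grid_max t n"
      unfolding grid_max_def h_def[symmetric] using j by (intro Max_ge) auto
    ultimately show ?thesis using err[OF j(1)] s(2) by linarith
  qed
  have "0 \<le> \<bar>v\<bar> * h" using h by simp
  then show ?thesis using upper lower unfolding h_def[symmetric] by (simp only: distrib_right)
qed

lemma grid_max_tendsto:
  assumes "0 \<le> t"
  shows "grid_max t \<longlonglongrightarrow> path_max t"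
proof -
  have "(\<lambda>n. (\<bar>v\<bar> + 2 * \<bar>v\<bar> * real (p t)) * (t / real n)) \<longlonglongrightarrow>
      (\<bar>v\<bar> + 2 * \<bar>v\<bar> * real (p t)) * 0"
    by (intro tendsto_mult tendsto_const lim_const_over_n)
  then have lim: "(\<lambda>n. (\<bar>v\<bar> + 2 * \<bar>v\<bar> * real (p t)) * (t / real n)) \<longlonglongrightarrow> 0" by simp
  have "(\<lambda>n. grid_max t n - path_max t) \<longlonglongrightarrow> 0"
  proof (rule Lim_null_comparison[OF _ lim])
    show "\<forall>\<^sub>F n in sequentially. norm (grid_max t n - path_max t)
        \<le> (\<bar>v\<bar> + 2 * \<bar>v\<bar> * real (p t)) * (t / real n)"
      using eventually_gt_at_top[of 0]
      by eventually_elim (use grid_max_error[OF assms] in \<open>auto simp: abs_minus_commute\<close>)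
  qed
  then show ?thesis by (simp add: LIM_zero_cancel)
qed

lemma path_max_bounds:
  assumes "0 \<le> t"
  shows "0 \<le> path_max t" "path_max t \<le> \<bar>v\<bar> * t"
proof -
  obtain s where s: "s \<in> {0..t}" "path_max t = position s"
    "\<And>r. r \<in> {0..t} \<Longrightarrow> position r \<le> path_max t"
    using path_max_attained[OF assms] by blast
  show "0 \<le> path_max t" using s(3)[of 0] assms by simp
  have "path_max t \<le> \<bar>v\<bar> * s" using position_lipschitz[of 0 s] s by simp
  also have "\<dots> \<le> \<bar>v\<bar> * t" using s by (intro mult_left_mono) auto
  finally show "path_max t \<le> \<bar>v\<bar> * t" .
qed

end

section \<open>The telegraph process\<close>

text \<open>Removing the first step shifts all nonempty partial sums by \<open>d\<close>; the empty
  sum accounts for \<open>max 0\<close> in the recursion.\<close>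

lemma Max_partial_sums_eq_walk_max:
  "Max ((\<lambda>i. \<Sum>j<i. d * (- 1) ^ count_list (take j bs) True) ` {..length bs}) = walk_max d bs"
proof (induction bs arbitrary: d)
  case (Cons b bs)
  let ?d = "if b then - d else d"
  let ?S = "\<lambda>i. \<Sum>j<i. ?d * (- 1) ^ count_list (take j bs) True"
  have "(\<lambda>i. \<Sum>j<i. d * (- 1) ^ count_list (take j (b # bs)) True) ` {..length (b # bs)} =
      insert 0 ((\<lambda>i. ?S i + d) ` {..length bs})"
    by (auto simp: atMost_Suc_eq_insert_0 image_image sum.lessThan_Suc_shift simp del: sum.lessThan_Suc)
  then have "Max ((\<lambda>i. \<Sum>j<i. d * (- 1) ^ count_list (take j (b # bs)) True) ` {..length (b # bs)}) =
      max 0 (Max ((\<lambda>i. ?S i + d) ` {..length bs}))"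
    by (simp add: Max_insert)
  also have "Max ((\<lambda>i. ?S i + d) ` {..length bs}) = Max (?S ` {..length bs}) + d"
    by (rule Max_add_commute) auto
  also have "Max (?S ` {..length bs}) = walk_max ?d bs" by (rule Cons)
  finally show ?case by (simp add: add.commute)
qed simp

context symmetric_telegraph
begin

abbreviation path :: "'a \<Rightarrow> real \<Rightarrow> nat" where
  "path \<omega> \<equiv> \<lambda>s. N s \<omega>"

lemma telegraph_path: "\<omega> \<in> space M \<Longrightarrow> telegraph_path (path \<omega>)"
  by (rule telegraph_path.intro) (use N_mono N_zero in auto)

lemma running_max_eq:
  assumes "\<omega> \<in> space M"
  shows "running_max (telegraph V0 N) t \<omega> = telegraph_path.path_max (path \<omega>) (V0 \<omega>) t"
proof -
  interpret telegraph_path "path \<omega>" "V0 \<omega>" using assms by (rule telegraph_path)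
  show ?thesis by (simp add: running_max_def path_max_def telegraph_def position_def[abs_def])
qed

definition grid_running_max :: "real \<Rightarrow> nat \<Rightarrow> 'a \<Rightarrow> real" where
  "grid_running_max t n \<omega> =
     Max ((\<lambda>i. t / real n * (\<Sum>j<i. V0 \<omega> * (- 1) ^ N (real j * (t / real n)) \<omega>)) ` {..n})"

lemma grid_running_max_tendsto:
  assumes "\<omega> \<in> space M" "0 \<le> t"
  shows "(\<lambda>n. grid_running_max t n \<omega>) \<longlonglongrightarrow> running_max (telegraph V0 N) t \<omega>"
proof -
  interpret telegraph_path "path \<omega>" "V0 \<omega>" using assms(1) by (rule telegraph_path)
  show ?thesis
    unfolding running_max_eq[OF assms(1)]
    using grid_max_tendsto[OF assms(2)]
    by (simp add: grid_running_max_def grid_max_def[abs_def] grid_position_def[abs_def])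
qed

lemma measurable_grid_running_max [measurable]:
  assumes "0 \<le> t"
  shows "grid_running_max t n \<in> borel_measurable M"
proof -
  have [measurable]: "(\<lambda>\<omega>. (- 1) ^ N (real j * (t / real n)) \<omega> :: real) \<in> borel_measurable M" for j
    using assms by (intro measurable_compose[OF random_variable_N]) auto
  have [measurable]: "V0 \<in> borel_measurable M" by (rule random_variable_V0)
  show ?thesis unfolding grid_running_max_def[abs_def] by measurable
qed

text \<open>A maximum over uncountably many times is a pointwise limit of maxima over finite grids,
  so the discretization yields measurability as well.\<close>

lemma measurable_running_max:
  assumes "0 \<le> t"
  shows "running_max (telegraph V0 N) t \<in> borel_measurable M"
  by (rule borel_measurable_LIMSEQ_real[where u = "grid_running_max t"])
    (use assms grid_running_max_tendsto measurable_grid_running_max in auto)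

section \<open>Jump patterns on a grid\<close>

definition jump_pattern :: "real \<Rightarrow> bool list \<Rightarrow> 'a set" where
  "jump_pattern t bs = {\<omega> \<in> space M. \<forall>j<length bs.
     N (real (Suc j) * (t / real (length bs))) \<omega> - N (real j * (t / real (length bs))) \<omega> = of_bool (bs ! j)}"

text \<open>Cells carry independent Poisson increments with the same mean, so only the number of
  jumps matters: words with equally many turns are equally likely.\<close>

lemma prob_jump_pattern:
  assumes "0 < t" "bs \<noteq> []"
  shows "prob (jump_pattern t bs) =
    (rate * t / real (length bs)) ^ count_list bs True * exp (- rate * t)"
proof -
  define n where "n = length bs"
  define h where "h = t / real n"
  have n: "0 < n" using assms by (simp add: n_def)
  have h: "0 < h" using assms n by (simp add: h_def)
  let ?I = "\<lambda>i \<omega>. N (real (Suc i) * h) \<omega> - N (real i * h) \<omega>"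
  have ind: "indep_vars (\<lambda>_. count_space UNIV) ?I {..<n}"
    by (rule independent_increments[of "\<lambda>i. real i * h"]) (use h in \<open>auto intro: mult_right_mono\<close>)
  have meas: "?I j \<in> measurable M (count_space UNIV)" if "j < n" for j
    using ind that by (auto simp: indep_vars_def)
  have "jump_pattern t bs = (\<Inter>j\<in>{..<n}. ?I j -` {of_bool (bs ! j)} \<inter> space M)"
    using n by (auto simp: jump_pattern_def n_def h_def)
  also have "prob \<dots> = (\<Prod>j<n. prob (?I j -` {of_bool (bs ! j)} \<inter> space M))"
    by (rule indep_varsD_finite[OF ind]) (use n in auto)
  also have "\<dots> = (\<Prod>j<n. exp (- rate * h) * (if bs ! j then rate * h else 1))"
  proof (rule prod.cong)
    fix j assume "j \<in> {..<n}"
    then have j: "j < n" by simp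
    have hh: "real (Suc j) * h - real j * h = h" by (simp add: algebra_simps)
    have "prob (?I j -` {of_bool (bs ! j)} \<inter> space M) =
        measure (distr M (count_space UNIV) (?I j)) {of_bool (bs ! j)}"
      by (rule measure_distr[symmetric]) (use meas[OF j] in auto)
    also have "distr M (count_space UNIV) (?I j) = measure_pmf (poisson_pmf (rate * h))"
      using poisson_increments[of "real j * h" "real (Suc j) * h"] h unfolding hh by simp
    also have "measure (measure_pmf (poisson_pmf (rate * h))) {of_bool (bs ! j)} =
        exp (- rate * h) * (if bs ! j then rate * h else 1)"
      using rate_pos h by (simp add: measure_pmf_single)
    finally show "prob (?I j -` {of_bool (bs ! j)} \<inter> space M) =
        exp (- rate * h) * (if bs ! j then rate * h else 1)" .
  qed simp
  also have "\<dots> = exp (- rate * h) ^ n * (\<Prod>j<n. if bs ! j then rate * h else 1)"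
    by (simp add: prod.distrib)
  also have "exp (- rate * h) ^ n = exp (- rate * t)"
    using n by (simp add: h_def flip: exp_of_nat_mult)
  also have "(\<Prod>j<n. if bs ! j then rate * h else 1) = (rate * h) ^ count_list bs True"
    unfolding n_def by (induction bs) (auto simp: prod.lessThan_Suc_shift simp del: prod.lessThan_Suc)
  finally show ?thesis by (simp add: h_def n_def mult.commute)
qed

lemma sets_jump_pattern: "0 \<le> t \<Longrightarrow> jump_pattern t bs \<in> events"
proof -
  assume "0 \<le> t"
  then have [measurable]: "N (real j * (t / real (length bs))) \<in> measurable M (count_space UNIV)" for j
    by (intro random_variable_N) simp
  show ?thesis unfolding jump_pattern_def by measurable
qed

lemma prob_V0_jump_pattern:
  assumes "0 \<le> t"
  shows "prob ({\<omega> \<in> space M. V0 \<omega> = - c} \<inter> jump_pattern t bs) = prob (jump_pattern t bs) / 2"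
proof -
  let ?P = "PiM {0..} (\<lambda>_. count_space UNIV) :: (real \<Rightarrow> nat) measure"
  let ?h = "t / real (length bs)"
  \<comment> \<open>Independence is assumed for events pulled back from path space, so the pattern
    is written as the preimage of a measurable set of paths.\<close>
  let ?S = "{f \<in> space ?P. \<forall>j<length bs. f (real (Suc j) * ?h) - f (real j * ?h) = of_bool (bs ! j)}"
  have [measurable]: "(\<lambda>f. f (real j * ?h)) \<in> measurable ?P (count_space UNIV)" for j
    using assms by (intro measurable_component_singleton) simp
  have S: "?S \<in> sets ?P" by measurable
  have eq: "jump_pattern t bs = (\<lambda>\<omega>. \<lambda>s\<in>{0..}. N s \<omega>) -` ?S \<inter> space M"
    using assms by (auto simp: jump_pattern_def space_PiM)
  have "jump_pattern t bs \<in>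
      sets (vimage_algebra (space M) (\<lambda>\<omega>. \<lambda>s\<in>{0..}. N s \<omega>) ?P)"
    unfolding eq by (rule in_vimage_algebra[OF S])
  moreover have "{\<omega> \<in> space M. V0 \<omega> = - c} \<in> sets (vimage_algebra (space M) V0 borel)"
    using in_vimage_algebra[of "{- c}" borel V0 "space M"]
    by (simp add: vimage_def Int_def conj_commute)
  ultimately show ?thesis
    using indep_setD[OF V0_indep_N] prob_V0_minus by (simp add: conj_commute)
qed

lemma N_eq_on_jump_pattern:
  assumes "\<omega> \<in> jump_pattern t bs" "0 \<le> t" "i \<le> length bs"
  shows "N (real i * (t / real (length bs))) \<omega> = count_list (take i bs) True"
  using assms(3)
proof (induction i)
  case 0
  then show ?case using assms N_zero by (simp add: jump_pattern_def)
next
  case (Suc i)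
  let ?h = "t / real (length bs)"
  have \<omega>: "\<omega> \<in> space M"
    and *: "N (real (Suc i) * ?h) \<omega> - N (real i * ?h) \<omega> = of_bool (bs ! i)"
    using assms Suc.prems by (auto simp: jump_pattern_def)
  have h: "0 \<le> ?h" using assms(2) by simp
  then have "real i * ?h \<le> real (Suc i) * ?h" by (intro mult_right_mono) simp_all
  moreover have "0 \<le> real i * ?h" by (rule mult_nonneg_nonneg[OF _ h]) simp
  moreover have "0 \<le> real (Suc i) * ?h" by (rule mult_nonneg_nonneg[OF _ h]) simp
  \<comment> \<open>Monotonicity excludes truncation in \<open>*\<close>, so the increments can be
    added up.\<close>
  ultimately have "N (real i * ?h) \<omega> \<le> N (real (Suc i) * ?h) \<omega>"
    by (intro mono_onD[OF N_mono[OF \<omega>]] atLeast_iff[THEN iffD2])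
  moreover have "N (real i * ?h) \<omega> = count_list (take i bs) True" using Suc by simp
  ultimately have "N (real (Suc i) * ?h) \<omega> = count_list (take i bs) True + of_bool (bs ! i)"
    using * by linarith
  then show ?case using Suc.prems by (simp add: take_Suc_conv_app_nth)
qed

lemma grid_running_max_on_jump_pattern:
  assumes \<omega>: "\<omega> \<in> jump_pattern t bs" and V: "V0 \<omega> = - c" and t: "0 \<le> t"
  shows "grid_running_max t (length bs) \<omega> =
    c * t / real (length bs) * real_of_int (walk_max (- 1) bs)"
proof -
  let ?n = "length bs"
  let ?h = "t / real ?n"
  let ?S = "\<lambda>i. \<Sum>j<i. - 1 * (- 1) ^ count_list (take j bs) True :: int"
  let ?f = "\<lambda>y::int. c * ?h * real_of_int y"
  have "0 \<le> c * ?h" using t speed_pos by simp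
  then have "mono ?f" by (intro monoI mult_left_mono) simp_all
  have "?h * (\<Sum>j<i. V0 \<omega> * (- 1) ^ N (real j * ?h) \<omega>) = ?f (?S i)" if "i \<le> ?n" for i
  proof -
    have "(\<Sum>j<i. V0 \<omega> * (- 1) ^ N (real j * ?h) \<omega>) =
        (\<Sum>j<i. c * real_of_int (- 1 * (- 1) ^ count_list (take j bs) True))"
      using that N_eq_on_jump_pattern[OF \<omega> t] V by (intro sum.cong) auto
    also have "\<dots> = c * real_of_int (?S i)" by (simp add: sum_distrib_left)
    finally show ?thesis by simp
  qed
  then have "grid_running_max t ?n \<omega> = Max ((\<lambda>i. ?f (?S i)) ` {..?n})"
    unfolding grid_running_max_def by (intro arg_cong[of _ _ Max] image_cong) auto
  also have "(\<lambda>i. ?f (?S i)) ` {..?n} = ?f ` ?S ` {..?n}" by (simp only: image_image)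
  also have "Max \<dots> = ?f (Max (?S ` {..?n}))"
    by (rule mono_Max_commute[OF \<open>mono ?f\<close>, symmetric]) auto
  finally show ?thesis unfolding Max_partial_sums_eq_walk_max by simp
qed

section \<open>The conditioning event and its approximation\<close>

definition even_event :: "real \<Rightarrow> nat \<Rightarrow> 'a set" where
  "even_event t k = {\<omega> \<in> space M. V0 \<omega> = - c \<and> N t \<omega> = 2 * k}"

text \<open>The part of \<open>even_event t k\<close> on which no grid cell contains two jumps.\<close>

definition simple_event :: "real \<Rightarrow> nat \<Rightarrow> nat \<Rightarrow> 'a set" where
  "simple_event t k n =
     (\<Union>bs\<in>turn_words n (2 * k). {\<omega> \<in> space M. V0 \<omega> = - c} \<inter> jump_pattern t bs)"

lemma sets_V0_minus: "{\<omega> \<in> space M. V0 \<omega> = - c} \<in> events"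
proof -
  have [measurable]: "V0 \<in> borel_measurable M" by (rule random_variable_V0)
  show ?thesis by measurable
qed

lemma sets_even_event: "0 \<le> t \<Longrightarrow> even_event t k \<in> events"
proof -
  assume "0 \<le> t"
  then have [measurable]: "N t \<in> measurable M (count_space UNIV)" by (rule random_variable_N)
  have [measurable]: "V0 \<in> borel_measurable M" by (rule random_variable_V0)
  show ?thesis unfolding even_event_def by measurable
qed

lemma sets_simple_event: "0 \<le> t \<Longrightarrow> simple_event t k n \<in> events"
  unfolding simple_event_def
  by (intro sets.finite_UN finite_turn_words sets.Int sets_V0_minus sets_jump_pattern) auto

lemma simple_event_subset:
  assumes "0 \<le> t" "0 < n"
  shows "simple_event t k n \<subseteq> even_event t k"
proof
  fix \<omega> assume "\<omega> \<in> simple_event t k n"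
  then obtain bs where bs: "length bs = n" "count_list bs True = 2 * k"
    and \<omega>: "\<omega> \<in> space M" "V0 \<omega> = - c" "\<omega> \<in> jump_pattern t bs"
    by (auto simp: simple_event_def turn_words_def)
  from N_eq_on_jump_pattern[OF \<omega>(3) assms(1), of n] bs assms(2)
  have "N t \<omega> = 2 * k" by simp
  with \<omega> show "\<omega> \<in> even_event t k" by (simp add: even_event_def)
qed

lemma jump_pattern_unique:
  assumes "\<omega> \<in> jump_pattern t bs" "\<omega> \<in> jump_pattern t bs'" "length bs = length bs'"
  shows "bs = bs'"
proof (rule nth_equalityI[OF assms(3)])
  fix j assume j: "j < length bs"
  let ?h = "t / real (length bs)"
  have "of_bool (bs ! j) = N (real (Suc j) * ?h) \<omega> - N (real j * ?h) \<omega>"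
    using assms(1) j by (simp add: jump_pattern_def)
  also have "\<dots> = of_bool (bs' ! j)" using assms(2,3) j by (simp add: jump_pattern_def)
  finally show "bs ! j = bs' ! j" by (simp only: of_bool_eq_iff)
qed

text \<open>The event is a disjoint union of patterns of equal probability, on each of which the
  grid maximum is constant.\<close>

lemma integral_simple_event:
  fixes g :: "real \<Rightarrow> real"
  assumes t: "0 < t" and n: "0 < n"
  shows "(LINT \<omega>|M. indicator (simple_event t k n) \<omega> * g (grid_running_max t n \<omega>)) =
    (rate * t / real n) ^ (2 * k) * exp (- rate * t) / 2 *
    (\<Sum>bs\<in>turn_words n (2 * k). g (c * t / real n * real_of_int (walk_max (- 1) bs)))"
proof -
  let ?A = "\<lambda>bs. {\<omega> \<in> space M. V0 \<omega> = - c} \<inter> jump_pattern t bs"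
  let ?w = "\<lambda>bs. g (c * t / real n * real_of_int (walk_max (- 1) bs))"
  have sets: "?A bs \<in> events" for bs
    using t by (intro sets.Int sets_V0_minus sets_jump_pattern) simp
  have disj: "disjoint_family_on ?A (turn_words n (2 * k))"
    by (auto simp: disjoint_family_on_def turn_words_def dest: jump_pattern_unique)
  have "indicator (simple_event t k n) \<omega> * g (grid_running_max t n \<omega>) =
      (\<Sum>bs\<in>turn_words n (2 * k). indicator (?A bs) \<omega> * ?w bs)" for \<omega>
  proof -
    have "indicator (simple_event t k n) \<omega> =
        (\<Sum>bs\<in>turn_words n (2 * k). indicator (?A bs) \<omega> :: real)"
      unfolding simple_event_def by (rule indicator_UN_disjoint[OF finite_turn_words disj])
    then have "indicator (simple_event t k n) \<omega> * g (grid_running_max t n \<omega>) =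
        (\<Sum>bs\<in>turn_words n (2 * k). indicator (?A bs) \<omega> * g (grid_running_max t n \<omega>))"
      by (simp only: sum_distrib_right)
    also have "\<dots> = (\<Sum>bs\<in>turn_words n (2 * k). indicator (?A bs) \<omega> * ?w bs)"
    proof (intro sum.cong refl)
      fix bs assume "bs \<in> turn_words n (2 * k)"
      then have "length bs = n" by (simp add: turn_words_def)
      then show "indicator (?A bs) \<omega> * g (grid_running_max t n \<omega>) = indicator (?A bs) \<omega> * ?w bs"
        using grid_running_max_on_jump_pattern[of \<omega> t bs] t by (auto simp: indicator_def)
    qed
    finally show ?thesis .
  qed
  then have "(LINT \<omega>|M. indicator (simple_event t k n) \<omega> * g (grid_running_max t n \<omega>)) =
      (LINT \<omega>|M. (\<Sum>bs\<in>turn_words n (2 * k). indicator (?A bs) \<omega> * ?w bs))" by simp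
  also have "\<dots> = (\<Sum>bs\<in>turn_words n (2 * k). LINT \<omega>|M. indicator (?A bs) \<omega> * ?w bs)"
    by (rule Bochner_Integration.integral_sum)
      (auto intro!: integrable_mult_left integrable_real_indicator sets simp: emeasure_eq_measure)
  also have "\<dots> = (\<Sum>bs\<in>turn_words n (2 * k). prob (?A bs) * ?w bs)"
    by (intro sum.cong refl) (simp add: Int_absorb2 sets.sets_into_space[OF sets])
  also have "\<dots> = (\<Sum>bs\<in>turn_words n (2 * k).
      (rate * t / real n) ^ (2 * k) * exp (- rate * t) / 2 * ?w bs)"
  proof (intro sum.cong refl)
    fix bs assume bs: "bs \<in> turn_words n (2 * k)"
    then have "bs \<noteq> []" using n by (auto simp: turn_words_def)
    then have "prob (?A bs) = (rate * t / real n) ^ (2 * k) * exp (- rate * t) / 2"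
      using prob_V0_jump_pattern[of t bs] prob_jump_pattern[of t bs] t bs
      by (simp add: turn_words_def)
    then show "prob (?A bs) * ?w bs =
        (rate * t / real n) ^ (2 * k) * exp (- rate * t) / 2 * ?w bs" by (simp only:)
  qed
  finally show ?thesis by (simp only: sum_distrib_left)
qed

lemma prob_even_event:
  assumes "0 < t"
  shows "prob (even_event t k) = (rate * t) ^ (2 * k) / fact (2 * k) * exp (- rate * t) / 2"
proof -
  let ?P = "PiM {0..} (\<lambda>_. count_space UNIV) :: (real \<Rightarrow> nat) measure"
  let ?S = "{f \<in> space ?P. f t = 2 * k}"
  let ?E = "N t -` {2 * k} \<inter> space M"
  have [measurable]: "(\<lambda>f. f t) \<in> measurable ?P (count_space UNIV)"
    using assms by (intro measurable_component_singleton) simp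
  have S: "?S \<in> sets ?P" by measurable
  have eq: "?E = (\<lambda>\<omega>. \<lambda>s\<in>{0..}. N s \<omega>) -` ?S \<inter> space M"
    using assms by (auto simp: space_PiM)
  have "?E \<in> sets (vimage_algebra (space M) (\<lambda>\<omega>. \<lambda>s\<in>{0..}. N s \<omega>) ?P)"
    unfolding eq by (rule in_vimage_algebra[OF S])
  moreover have "V0 -` {- c} \<inter> space M \<in> sets (vimage_algebra (space M) V0 borel)"
    by (rule in_vimage_algebra) simp
  ultimately have "prob ((V0 -` {- c} \<inter> space M) \<inter> ?E) = prob (V0 -` {- c} \<inter> space M) * prob ?E"
    by (intro indep_setD[OF V0_indep_N])
  moreover have "(V0 -` {- c} \<inter> space M) \<inter> ?E = even_event t k" by (auto simp: even_event_def)
  moreover have "V0 -` {- c} \<inter> space M = {\<omega> \<in> space M. V0 \<omega> = - c}" by auto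
  moreover have "prob ?E = (rate * t) ^ (2 * k) / fact (2 * k) * exp (- rate * t)"
  proof -
    have "prob ?E = measure (distr M (count_space UNIV) (N t)) {2 * k}"
      by (rule measure_distr[symmetric]) (use random_variable_N[of t] assms in auto)
    also have "distr M (count_space UNIV) (N t) =
        distr M (count_space UNIV) (\<lambda>\<omega>. N t \<omega> - N 0 \<omega>)"
      by (intro distr_cong) (auto simp: N_zero)
    also have "\<dots> = measure_pmf (poisson_pmf (rate * t))"
      using poisson_increments[of 0 t] assms by simp
    also have "measure \<dots> {2 * k} = (rate * t) ^ (2 * k) / fact (2 * k) * exp (- rate * t)"
      using rate_pos assms by (simp add: measure_pmf_single)
    finally show ?thesis .
  qed
  ultimately show ?thesis using prob_V0_minus by simp
qed

lemma prob_even_event_pos: "0 < t \<Longrightarrow> 0 < prob (even_event t k)"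
  using rate_pos by (simp add: prob_even_event)

lemma card_turn_words: "card (turn_words n j) = n choose j"
proof (induction n arbitrary: j)
  case (Suc n)
  have "card (turn_words (Suc n) j) = (\<Sum>bs\<in>turn_words (Suc n) j. 1)" by simp
  then show ?case unfolding sum_turn_words_Suc by (cases j) (auto simp: Suc)
qed (auto simp: turn_words_0)

text \<open>Both probabilities are explicit, so no estimate for two jumps in one cell is needed.\<close>

lemma prob_simple_event_tendsto:
  assumes t: "0 < t"
  shows "(\<lambda>n. prob (simple_event t k n)) \<longlonglongrightarrow> prob (even_event t k)"
proof -
  have "(\<lambda>n. real n / real n) \<longlonglongrightarrow> 1"
    by (rule tendsto_eventually) (auto intro: eventually_mono[OF eventually_gt_at_top[of 0]])
  note tendsto_binomial_over_power[OF this, of "2 * k"]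
  then have lim: "(\<lambda>n. real (n choose (2 * k)) / real n ^ (2 * k) * ((rate * t) ^ (2 * k) * exp (- rate * t) / 2))
      \<longlonglongrightarrow> 1 ^ (2 * k) / fact (2 * k) * ((rate * t) ^ (2 * k) * exp (- rate * t) / 2)"
    by (intro tendsto_mult tendsto_const)
  have eq: "1 ^ (2 * k) / fact (2 * k) * ((rate * t) ^ (2 * k) * exp (- rate * t) / 2) =
      prob (even_event t k)"
    by (simp add: prob_even_event[OF t])
  have ev: "\<forall>\<^sub>F n in sequentially. real (n choose (2 * k)) / real n ^ (2 * k) *
      ((rate * t) ^ (2 * k) * exp (- rate * t) / 2) = prob (simple_event t k n)"
    using eventually_gt_at_top[of 0]
  proof eventually_elim
    case (elim n)
    \<comment> \<open>The constant test function 1 turns the integral into a count of words.\<close>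
    have "prob (simple_event t k n) =
        (rate * t / real n) ^ (2 * k) * exp (- rate * t) / 2 * real (n choose (2 * k))"
      using integral_simple_event[OF t elim, of k "\<lambda>_. 1"] t
      by (simp add: card_turn_words Int_absorb2 sets.sets_into_space[OF sets_simple_event])
    then show ?case by (simp add: power_divide)
  qed
  show ?thesis by (rule Lim_transform_eventually[OF lim[unfolded eq] ev])
qed

section \<open>Conditional expectations as limits of sums over words\<close>

lemma cond_expectation_eq:
  assumes [measurable]: "X \<in> borel_measurable M" and "{\<omega> \<in> space M. Q \<omega>} \<in> events"
  shows "cond_expectation M X Q =
    (LINT \<omega>|M. indicator {\<omega> \<in> space M. Q \<omega>} \<omega> * X \<omega>) / prob {\<omega> \<in> space M. Q \<omega>}"
proof -
  let ?A = "{\<omega> \<in> space M. Q \<omega>}"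
  have [measurable]: "?A \<in> events" by fact
  show ?thesis
  proof (cases "prob ?A = 0")
    \<comment> \<open>Both sides are 0: the left one because the event is null, the right one
      because division by 0 gives 0.\<close>
    case True
    then have null: "?A \<in> null_sets M" by (simp add: emeasure_eq_measure null_sets_def)
    have "cond_expectation M X Q = 0"
      unfolding cond_expectation_def
    proof (intro integral_eq_zero_AE AE_uniform_measureI)
      show "AE \<omega> in M. \<omega> \<in> ?A \<longrightarrow> X \<omega> = 0"
        using AE_not_in[OF null] by eventually_elim blast
    qed simp
    then show ?thesis using True by simp
  next
    case False
    then have pos: "prob ?A > 0" by (simp add: zero_less_measure_iff)
    have "uniform_measure M ?A = density M (\<lambda>\<omega>. ennreal (indicator ?A \<omega> / prob ?A))"
      unfolding uniform_measure_def emeasure_eq_measure using pos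
      by (intro density_cong) (auto simp: divide_ennreal ennreal_indicator[symmetric])
    then have "cond_expectation M X Q = (LINT \<omega>|M. (indicator ?A \<omega> / prob ?A) *\<^sub>R X \<omega>)"
      unfolding cond_expectation_def by (simp only:) (rule integral_density, auto)
    then show ?thesis by simp
  qed
qed

lemma running_max_bounds:
  assumes "\<omega> \<in> even_event t k" "0 \<le> t"
  shows "0 \<le> running_max (telegraph V0 N) t \<omega>" "running_max (telegraph V0 N) t \<omega> \<le> c * t"
proof -
  have \<omega>: "\<omega> \<in> space M" "V0 \<omega> = - c" using assms by (auto simp: even_event_def)
  interpret telegraph_path "path \<omega>" "V0 \<omega>" using \<omega>(1) by (rule telegraph_path)
  show "0 \<le> running_max (telegraph V0 N) t \<omega>" "running_max (telegraph V0 N) t \<omega> \<le> c * t"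
    using path_max_bounds[OF assms(2)] speed_pos by (simp_all add: running_max_eq[OF \<omega>(1)] \<omega>(2))
qed

lemma measurable_continuous_running_max:
  fixes g :: "real \<Rightarrow> real"
  assumes "continuous_on UNIV g" "0 \<le> t"
  shows "(\<lambda>\<omega>. g (running_max (telegraph V0 N) t \<omega>)) \<in> borel_measurable M"
  by (rule measurable_compose[OF measurable_running_max[OF assms(2)]
        borel_measurable_continuous_onI[OF assms(1)]])

text \<open>Two replacements: the grid maximum for the running one, by dominated convergence, and
  \<open>simple_event\<close> for \<open>even_event\<close>, at a cost of at most \<open>B\<close>
  times the gap between their probabilities. Dividing by the probability of the condition cancels
  the powers of \<open>rate * t\<close>, the exponential and the factor 1 / 2, and leaves (2 k)! /
  n^(2 k).\<close>

lemma cond_expectation_tendsto: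
  fixes g :: "real \<Rightarrow> real"
  assumes t: "0 < t" and cont: "continuous_on UNIV g" and bnd: "\<And>y. \<bar>g y\<bar> \<le> B"
  shows "(\<lambda>n. fact (2 * k) / real n ^ (2 * k) *
      (\<Sum>bs\<in>turn_words n (2 * k). g (c * t / real n * real_of_int (walk_max (- 1) bs))))
    \<longlonglongrightarrow> cond_expectation M (\<lambda>\<omega>. g (running_max (telegraph V0 N) t \<omega>))
      (\<lambda>\<omega>. V0 \<omega> = - c \<and> N t \<omega> = 2 * k)"
proof -
  let ?A = "even_event t k" and ?G = "simple_event t k"
  let ?rm = "running_max (telegraph V0 N) t"
  have [measurable]: "?A \<in> events" "?G n \<in> events" for n
    using t by (auto intro!: sets_even_event sets_simple_event)
  have gm [measurable]: "g \<in> borel_measurable borel" by (rule borel_measurable_continuous_onI[OF cont])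
  have [measurable]: "?rm \<in> borel_measurable M" "grid_running_max t n \<in> borel_measurable M" for n
    using t by (auto intro!: measurable_running_max measurable_grid_running_max)
  have B: "0 \<le> B" using bnd[of 0] by linarith
  have "(\<lambda>n. LINT \<omega>|M. indicator ?A \<omega> * g (grid_running_max t n \<omega>)) \<longlonglongrightarrow>
      (LINT \<omega>|M. indicator ?A \<omega> * g (?rm \<omega>))"
  proof (rule integral_dominated_convergence[where w = "\<lambda>_. B"])
    show "AE \<omega> in M. (\<lambda>n. indicator ?A \<omega> * g (grid_running_max t n \<omega>)) \<longlonglongrightarrow> indicator ?A \<omega> * g (?rm \<omega>)"
    proof (rule AE_I2)
      fix \<omega> assume "\<omega> \<in> space M"
      then have "(\<lambda>n. g (grid_running_max t n \<omega>)) \<longlonglongrightarrow> g (?rm \<omega>)"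
        using t by (intro continuous_on_tendsto_compose[OF cont] grid_running_max_tendsto) auto
      then show "(\<lambda>n. indicator ?A \<omega> * g (grid_running_max t n \<omega>)) \<longlonglongrightarrow> indicator ?A \<omega> * g (?rm \<omega>)"
        by (intro tendsto_intros)
    qed
    show "AE \<omega> in M. norm (indicator ?A \<omega> * g (grid_running_max t n \<omega>)) \<le> B" for n
      using bnd B by (auto simp: indicator_def)
  qed auto
  moreover have "(\<lambda>n. (LINT \<omega>|M. indicator ?A \<omega> * g (grid_running_max t n \<omega>)) -
      (LINT \<omega>|M. indicator (?G n) \<omega> * g (grid_running_max t n \<omega>))) \<longlonglongrightarrow> 0"
  proof (rule Lim_null_comparison)
    have "(\<lambda>n. B * (prob ?A - prob (?G n))) \<longlonglongrightarrow> B * (prob ?A - prob ?A)"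
      by (intro tendsto_intros prob_simple_event_tendsto t)
    then show "(\<lambda>n. B * (prob ?A - prob (?G n))) \<longlonglongrightarrow> 0" by simp
    show "\<forall>\<^sub>F n in sequentially. norm ((LINT \<omega>|M. indicator ?A \<omega> * g (grid_running_max t n \<omega>)) -
        (LINT \<omega>|M. indicator (?G n) \<omega> * g (grid_running_max t n \<omega>))) \<le> B * (prob ?A - prob (?G n))"
      using eventually_gt_at_top[of 0]
    proof eventually_elim
      case (elim n)
      have sub: "?G n \<subseteq> ?A" using t elim by (intro simple_event_subset) auto
      have int: "integrable M (\<lambda>\<omega>. indicator S \<omega> * g (grid_running_max t n \<omega>))"
        if [measurable]: "S \<in> events" for S
        by (rule integrable_const_bound[where B = B]) (use bnd B in \<open>auto simp: indicator_def\<close>)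
      note i1 = int[OF \<open>?A \<in> events\<close>] and i2 = int[OF \<open>?G n \<in> events\<close>]
      have eq: "(LINT \<omega>|M. indicator ?A \<omega> * g (grid_running_max t n \<omega>)) -
          (LINT \<omega>|M. indicator (?G n) \<omega> * g (grid_running_max t n \<omega>)) =
          (LINT \<omega>|M. indicator ?A \<omega> * g (grid_running_max t n \<omega>) -
            indicator (?G n) \<omega> * g (grid_running_max t n \<omega>))"
        by (rule Bochner_Integration.integral_diff[OF i1 i2, symmetric])
      have "norm ((LINT \<omega>|M. indicator ?A \<omega> * g (grid_running_max t n \<omega>)) -
          (LINT \<omega>|M. indicator (?G n) \<omega> * g (grid_running_max t n \<omega>))) \<le>
          (LINT \<omega>|M. norm (indicator ?A \<omega> * g (grid_running_max t n \<omega>) -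
            indicator (?G n) \<omega> * g (grid_running_max t n \<omega>)))"
        unfolding eq by (rule integral_norm_bound)
      also have "\<dots> \<le> (LINT \<omega>|M. B * indicator (?A - ?G n) \<omega>)"
      proof (rule integral_mono)
        show "integrable M (\<lambda>\<omega>. norm (indicator ?A \<omega> * g (grid_running_max t n \<omega>) -
            indicator (?G n) \<omega> * g (grid_running_max t n \<omega>)))"
          by (rule integrable_norm[OF Bochner_Integration.integrable_diff[OF i1 i2]])
        show "integrable M (\<lambda>\<omega>. B * indicator (?A - ?G n) \<omega>)"
          by (rule integrable_const_bound[where B = B]) (use B in \<open>auto simp: indicator_def\<close>)
        show "norm (indicator ?A \<omega> * g (grid_running_max t n \<omega>) -
            indicator (?G n) \<omega> * g (grid_running_max t n \<omega>)) \<le> B * indicator (?A - ?G n) \<omega>" for \<omega>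
          using bnd[of "grid_running_max t n \<omega>"] B sub
          by (cases "\<omega> \<in> ?A"; cases "\<omega> \<in> ?G n") auto
      qed
      also have "\<dots> = B * prob (?A - ?G n)"
        using sets.sets_into_space[of ?A M] by (simp add: Int_absorb2 Diff_subset[THEN subset_trans])
      finally show ?case using finite_measure_Diff[OF \<open>?A \<in> events\<close> \<open>?G n \<in> events\<close> sub] by (simp only:)
    qed
  qed
  ultimately have "(\<lambda>n. (LINT \<omega>|M. indicator ?A \<omega> * g (grid_running_max t n \<omega>)) -
      ((LINT \<omega>|M. indicator ?A \<omega> * g (grid_running_max t n \<omega>)) -
       (LINT \<omega>|M. indicator (?G n) \<omega> * g (grid_running_max t n \<omega>))))
      \<longlonglongrightarrow> (LINT \<omega>|M. indicator ?A \<omega> * g (?rm \<omega>)) - 0"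
    by (rule tendsto_diff)
  then have "(\<lambda>n. LINT \<omega>|M. indicator (?G n) \<omega> * g (grid_running_max t n \<omega>)) \<longlonglongrightarrow>
      (LINT \<omega>|M. indicator ?A \<omega> * g (?rm \<omega>))" by simp
  then have "(\<lambda>n. (LINT \<omega>|M. indicator (?G n) \<omega> * g (grid_running_max t n \<omega>)) / prob ?A) \<longlonglongrightarrow>
      (LINT \<omega>|M. indicator ?A \<omega> * g (?rm \<omega>)) / prob ?A"
    by (rule tendsto_divide[OF _ tendsto_const]) (use prob_even_event_pos[OF t, of k] in auto)
  also have "(LINT \<omega>|M. indicator ?A \<omega> * g (?rm \<omega>)) / prob ?A =
      cond_expectation M (\<lambda>\<omega>. g (?rm \<omega>)) (\<lambda>\<omega>. V0 \<omega> = - c \<and> N t \<omega> = 2 * k)"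
    unfolding even_event_def
    by (rule cond_expectation_eq[symmetric])
      (use sets_even_event[of t k] t in \<open>auto simp: even_event_def\<close>)
  finally have lim: "(\<lambda>n. (LINT \<omega>|M. indicator (?G n) \<omega> * g (grid_running_max t n \<omega>)) / prob ?A) \<longlonglongrightarrow>
      cond_expectation M (\<lambda>\<omega>. g (?rm \<omega>)) (\<lambda>\<omega>. V0 \<omega> = - c \<and> N t \<omega> = 2 * k)" .
  show ?thesis
  proof (rule Lim_transform_eventually[OF lim])
    show "\<forall>\<^sub>F n in sequentially. (LINT \<omega>|M. indicator (?G n) \<omega> * g (grid_running_max t n \<omega>)) / prob ?A =
        fact (2 * k) / real n ^ (2 * k) *
        (\<Sum>bs\<in>turn_words n (2 * k). g (c * t / real n * real_of_int (walk_max (- 1) bs)))"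
      using eventually_gt_at_top[of 0]
    proof eventually_elim
      case (elim n)
      show ?case
        unfolding integral_simple_event[OF t elim] prob_even_event[OF t]
        using t rate_pos elim by (simp add: power_divide)
    qed
  qed
qed

text \<open>Without jumps the path only descends and the law is the atom alone, so there is no
  density and the case stands apart.\<close>

lemma cond_expectation_0:
  fixes g :: "real \<Rightarrow> real"
  assumes t: "0 < t" and cont: "continuous_on UNIV g" and bnd: "\<And>y. \<bar>g y\<bar> \<le> B"
    and g: "\<And>y. y \<le> 0 \<Longrightarrow> g y = 0"
  shows "cond_expectation M (\<lambda>\<omega>. g (running_max (telegraph V0 N) t \<omega>))
      (\<lambda>\<omega>. V0 \<omega> = - c \<and> N t \<omega> = 2 * 0) = 0"
proof (rule LIMSEQ_unique[OF cond_expectation_tendsto[OF t cont bnd]])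
  have "(\<Sum>bs\<in>turn_words n (2 * 0). g (c * t / real n * real_of_int (walk_max (- 1) bs))) = 0" for n
    by (subst sum_walk_max_eq) (use t speed_pos g in auto)
  then show "(\<lambda>n. fact (2 * 0) / real n ^ (2 * 0) *
      (\<Sum>bs\<in>turn_words n (2 * 0). g (c * t / real n * real_of_int (walk_max (- 1) bs)))) \<longlonglongrightarrow> 0"
    by simp
qed

lemma cond_expectation_Suc:
  fixes g :: "real \<Rightarrow> real"
  assumes t: "0 < t" and cont: "continuous_on UNIV g" and bnd: "\<And>y. \<bar>g y\<bar> \<le> B"
    and g: "\<And>y. y \<le> 0 \<Longrightarrow> g y = 0"
  shows "cond_expectation M (\<lambda>\<omega>. g (running_max (telegraph V0 N) t \<omega>))
      (\<lambda>\<omega>. V0 \<omega> = - c \<and> N t \<omega> = 2 * Suc k) =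
    integral {0..1} (\<lambda>x. max_density k x * g (c * t * x))"
  by (rule LIMSEQ_unique[OF cond_expectation_tendsto[OF t cont bnd] walk_max_limit_density[OF g cont bnd]])
    (use t speed_pos in auto)

lemma cond_expectation_cong:
  assumes "\<And>\<omega>. \<omega> \<in> even_event t k \<Longrightarrow> X \<omega> = Y \<omega>" "0 \<le> t"
    and "X \<in> borel_measurable M" "Y \<in> borel_measurable M"
  shows "cond_expectation M X (\<lambda>\<omega>. V0 \<omega> = - c \<and> N t \<omega> = 2 * k) =
    cond_expectation M Y (\<lambda>\<omega>. V0 \<omega> = - c \<and> N t \<omega> = 2 * k)"
proof -
  have "(\<lambda>\<omega>. indicator (even_event t k) \<omega> * X \<omega>) = (\<lambda>\<omega>. indicator (even_event t k) \<omega> * Y \<omega>)"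
    using assms(1) by (auto simp: indicator_def)
  then show ?thesis
    unfolding even_event_def
    by (simp only: cond_expectation_eq[OF assms(3) sets_even_event[OF assms(2), unfolded even_event_def]]
        cond_expectation_eq[OF assms(4) sets_even_event[OF assms(2), unfolded even_event_def]])
qed

section \<open>Moments and the atom at zero\<close>

lemma cond_expectation_running_max_power:
  assumes t: "0 < t" and m: "1 \<le> m"
  shows "cond_expectation M (\<lambda>\<omega>. running_max (telegraph V0 N) t \<omega> ^ m)
      (\<lambda>\<omega>. V0 \<omega> = - c \<and> N t \<omega> = 2 * k) =
    fact (2 * k) * (c * t) ^ m / (2 ^ (2 * k) * fact k) *
      (Gamma ((real m + 1) / 2) / Gamma (real k + (real m + 1) / 2)
       - Gamma (real m / 2 + 1) / Gamma (real k + 1 + real m / 2))"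
proof -
  \<comment> \<open>The power is truncated to a bounded function; this is invisible because the
    maximum lies in [0, c t] on the event. As m \<ge> 1, it vanishes at 0 and the atom does not
    contribute.\<close>
  define g where "g = (\<lambda>y. max 0 (min y (c * t)) ^ m)"
  have ct: "0 < c * t" using t speed_pos by simp
  have cont: "continuous_on UNIV g" unfolding g_def by (intro continuous_intros)
  have bnd: "\<bar>g y\<bar> \<le> (c * t) ^ m" for y
    unfolding g_def using ct by (auto simp: power_abs intro!: power_mono)
  have g0: "g y = 0" if "y \<le> 0" for y using that m by (simp add: g_def min_def)
  have "cond_expectation M (\<lambda>\<omega>. running_max (telegraph V0 N) t \<omega> ^ m)
      (\<lambda>\<omega>. V0 \<omega> = - c \<and> N t \<omega> = 2 * k) =
      cond_expectation M (\<lambda>\<omega>. g (running_max (telegraph V0 N) t \<omega>))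
      (\<lambda>\<omega>. V0 \<omega> = - c \<and> N t \<omega> = 2 * k)"
  proof (rule cond_expectation_cong)
    fix \<omega> assume "\<omega> \<in> even_event t k"
    from running_max_bounds[OF this] t
    show "running_max (telegraph V0 N) t \<omega> ^ m = g (running_max (telegraph V0 N) t \<omega>)"
      by (simp add: g_def)
  qed (use t in \<open>auto intro!: measurable_continuous_running_max cont borel_measurable_power measurable_running_max\<close>)
  also have "\<dots> = fact (2 * k) * (c * t) ^ m / (2 ^ (2 * k) * fact k) *
      (Gamma ((real m + 1) / 2) / Gamma (real k + (real m + 1) / 2)
       - Gamma (real m / 2 + 1) / Gamma (real k + 1 + real m / 2))"
  proof (cases k)
    case 0
    \<comment> \<open>For k = 0 both quotients are 1 and the bracket vanishes.\<close>
    have "Gamma ((real m + 1) / 2) \<noteq> 0" "Gamma (real m / 2 + 1) \<noteq> 0"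
      by (rule less_imp_neq[symmetric], simp)+
    then show ?thesis using cond_expectation_0[OF t cont bnd g0] 0 by (simp add: add.commute)
  next
    case (Suc j)
    have "cond_expectation M (\<lambda>\<omega>. g (running_max (telegraph V0 N) t \<omega>))
        (\<lambda>\<omega>. V0 \<omega> = - c \<and> N t \<omega> = 2 * k) = integral {0..1} (\<lambda>x. max_density j x * g (c * t * x))"
      unfolding Suc by (rule cond_expectation_Suc[OF t cont bnd g0])
    also have "\<dots> = integral {0..1} (\<lambda>x. (c * t) ^ m * (max_density j x * x ^ m))"
    proof (rule integral_cong)
      fix x :: real assume "x \<in> {0..1}"
      then have "0 \<le> c * t * x" "c * t * x \<le> c * t" using ct by (auto intro: mult_left_le)
      then show "max_density j x * g (c * t * x) = (c * t) ^ m * (max_density j x * x ^ m)"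
        by (simp add: g_def power_mult_distrib)
    qed
    also have "\<dots> = (c * t) ^ m * (fact (2 * k) / (2 ^ (2 * k) * fact k) *
      (Gamma ((real m + 1) / 2) / Gamma (real k + (real m + 1) / 2)
       - Gamma (real m / 2 + 1) / Gamma (real k + 1 + real m / 2)))"
      unfolding Suc by (rule integral_unique[OF has_integral_mult_right[OF has_integral_max_density_power]])
    also have "a * (b / d * z) = b * a / d * z" for a b d z :: real by simp
    finally show ?thesis .
  qed
  finally show ?thesis .
qed

text \<open>The mass on \<open>{0<..}\<close> is obtained from the test functions \<open>min 1 (n y\<^sup>+)\<close>, since the limit theorem only
  admits continuous ones.\<close>

lemma cond_prob_running_max_pos:
  assumes t: "0 < t"
  shows "(LINT \<omega>|M. indicator (even_event t k) \<omega> * of_bool (0 < running_max (telegraph V0 N) t \<omega>)) /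
      prob (even_event t k) = 1 - fact (2 * k) / ((fact k)\<^sup>2 * 2 ^ (2 * k))"
proof -
  define g where "g = (\<lambda>n y. min 1 (max 0 (real n * y)))"
  let ?rm = "running_max (telegraph V0 N) t" and ?A = "even_event t k"
  have cont: "continuous_on UNIV (g n)" for n unfolding g_def by (intro continuous_intros)
  have bnd: "\<bar>g n y\<bar> \<le> 1" for n y by (simp add: g_def)
  have g0: "g n y = 0" if "y \<le> 0" for n y using that by (simp add: g_def mult_nonneg_nonpos)
  have lim: "(\<lambda>n. g n y) \<longlonglongrightarrow> of_bool (0 < y)" for y
  proof (cases "0 < y")
    case True
    obtain n0 :: nat where "1 / y < real n0" using reals_Archimedean2 by blast
    then have "\<forall>\<^sub>F n in sequentially. g n y = of_bool (0 < y)"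
      unfolding eventually_sequentially
    proof (intro exI[of _ n0] allI impI)
      fix n assume "n0 \<le> n"
      with \<open>1 / y < real n0\<close> have "1 / y \<le> real n" by linarith
      then have "1 \<le> real n * y" using True by (simp add: field_simps)
      then show "g n y = of_bool (0 < y)" using True by (simp add: g_def)
    qed
    then show ?thesis by (rule tendsto_eventually)
  qed (simp add: g0)
  have [measurable]: "?A \<in> events" using t by (intro sets_even_event) simp
  have [measurable]: "?rm \<in> borel_measurable M" using t by (intro measurable_running_max) simp
  have gm [measurable]: "g n \<in> borel_measurable borel" for n
    by (rule borel_measurable_continuous_onI[OF cont])
  have "(\<lambda>n. LINT \<omega>|M. indicator ?A \<omega> * g n (?rm \<omega>)) \<longlonglongrightarrow>
      (LINT \<omega>|M. indicator ?A \<omega> * of_bool (0 < ?rm \<omega>))"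
  proof (rule integral_dominated_convergence[where w = "\<lambda>_. 1"])
    show "AE \<omega> in M. (\<lambda>n. indicator ?A \<omega> * g n (?rm \<omega>)) \<longlonglongrightarrow> indicator ?A \<omega> * of_bool (0 < ?rm \<omega>)"
      by (intro AE_I2 tendsto_mult tendsto_const lim)
    show "AE \<omega> in M. norm (indicator ?A \<omega> * g n (?rm \<omega>)) \<le> 1" for n
      using bnd by (auto simp: indicator_def)
  qed auto
  then have "(\<lambda>n. (LINT \<omega>|M. indicator ?A \<omega> * g n (?rm \<omega>)) / prob ?A) \<longlonglongrightarrow>
      (LINT \<omega>|M. indicator ?A \<omega> * of_bool (0 < ?rm \<omega>)) / prob ?A"
    using prob_even_event_pos[OF t, of k] by (intro tendsto_intros) auto
  moreover have "(LINT \<omega>|M. indicator ?A \<omega> * g n (?rm \<omega>)) / prob ?A =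
      cond_expectation M (\<lambda>\<omega>. g n (?rm \<omega>)) (\<lambda>\<omega>. V0 \<omega> = - c \<and> N t \<omega> = 2 * k)" for n
    unfolding even_event_def
    by (rule cond_expectation_eq[symmetric])
      (use sets_even_event[of t k] t in \<open>auto simp: even_event_def\<close>)
  ultimately have lim1: "(\<lambda>n. cond_expectation M (\<lambda>\<omega>. g n (?rm \<omega>)) (\<lambda>\<omega>. V0 \<omega> = - c \<and> N t \<omega> = 2 * k))
      \<longlonglongrightarrow> (LINT \<omega>|M. indicator ?A \<omega> * of_bool (0 < ?rm \<omega>)) / prob ?A" by simp
  have lim2: "(\<lambda>n. cond_expectation M (\<lambda>\<omega>. g n (?rm \<omega>)) (\<lambda>\<omega>. V0 \<omega> = - c \<and> N t \<omega> = 2 * k))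
      \<longlonglongrightarrow> 1 - fact (2 * k) / ((fact k)\<^sup>2 * 2 ^ (2 * k))"
  proof (cases k)
    case 0
    then show ?thesis using cond_expectation_0[OF t cont bnd g0] by simp
  next
    case (Suc j)
    have ct: "0 < c * t" using t speed_pos by simp
    let ?D = "\<lambda>x. max_density j x * of_bool (0 < c * t * x)"
    have "(\<lambda>n. integral {0..1} (\<lambda>x. max_density j x * g n (c * t * x))) \<longlonglongrightarrow> integral {0..1} ?D"
    proof (rule dominated_convergence(2)[where h = "\<lambda>x. \<bar>max_density j x\<bar>"])
      show "(\<lambda>x. max_density j x * g n (c * t * x)) integrable_on {0..1}" for n
        by (intro integrable_continuous_real continuous_intros continuous_on_max_density
            continuous_on_compose2[OF cont]) auto
      show "(\<lambda>x. \<bar>max_density j x\<bar>) integrable_on {0..1}"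
        by (intro integrable_continuous_real continuous_intros continuous_on_max_density)
      show "norm (max_density j x * g n (c * t * x)) \<le> \<bar>max_density j x\<bar>" for n x
        using bnd[of n "c * t * x"] by (auto simp: abs_mult intro: mult_left_le)
      show "(\<lambda>n. max_density j x * g n (c * t * x)) \<longlonglongrightarrow> ?D x" for x
        by (intro tendsto_mult tendsto_const lim)
    qed
    moreover have "integral {0..1} ?D = 1 - fact (2 * k) / ((fact k)\<^sup>2 * 2 ^ (2 * k))"
    proof (rule integral_unique)
      \<comment> \<open>The mass is the moment of order 0; the indicator in \<open>?D\<close>
        differs from 1 only at x = 0.\<close>
      have "(max_density j has_integral 1 - fact (2 * k) / ((fact k)\<^sup>2 * 2 ^ (2 * k))) {0..1}"
        using has_integral_max_density_power[of j 0] unfolding Suc moment_formula_0[of "Suc j"] by simp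
      then show "(?D has_integral 1 - fact (2 * k) / ((fact k)\<^sup>2 * 2 ^ (2 * k))) {0..1}"
        by (rule has_integral_spike_finite[of "{0}", rotated 2]) (use ct in \<open>auto simp: zero_less_mult_iff\<close>)
    qed
    moreover have "cond_expectation M (\<lambda>\<omega>. g n (?rm \<omega>)) (\<lambda>\<omega>. V0 \<omega> = - c \<and> N t \<omega> = 2 * k) =
        integral {0..1} (\<lambda>x. max_density j x * g n (c * t * x))" for n
      unfolding Suc by (rule cond_expectation_Suc[OF t cont bnd g0])
    ultimately show ?thesis by (simp only:)
  qed
  show ?thesis by (rule LIMSEQ_unique[OF lim1 lim2])
qed

lemma cond_prob_running_max_zero:
  assumes t: "0 < t"
  shows "\<P>(\<omega> in M. running_max (telegraph V0 N) t \<omega> = 0 \<bar> V0 \<omega> = - c \<and> N t \<omega> = 2 * k) =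
    fact (2 * k) / ((fact k)\<^sup>2 * 2 ^ (2 * k))"
proof -
  let ?rm = "running_max (telegraph V0 N) t" and ?A = "even_event t k"
  let ?P = "{\<omega> \<in> space M. 0 < ?rm \<omega>}"
  have A [measurable]: "?A \<in> events" using t by (intro sets_even_event) simp
  have rm [measurable]: "?rm \<in> borel_measurable M" using t by (intro measurable_running_max) simp
  have "(LINT \<omega>|M. indicator ?A \<omega> * of_bool (0 < ?rm \<omega>)) = (LINT \<omega>|M. indicator (?A \<inter> ?P) \<omega> :: real)"
    by (intro Bochner_Integration.integral_cong) (auto simp: indicator_def)
  also have "\<dots> = prob (?A \<inter> ?P)" by (simp add: Int_absorb2 sets.sets_into_space)
  finally have "prob (?A \<inter> ?P) / prob ?A = 1 - fact (2 * k) / ((fact k)\<^sup>2 * 2 ^ (2 * k))"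
    using cond_prob_running_max_pos[OF t, of k] by simp
  \<comment> \<open>The maximum is nonnegative on the event, so vanishing is the complement of being
    positive.\<close>
  moreover have "{\<omega> \<in> space M. ?rm \<omega> = 0 \<and> V0 \<omega> = - c \<and> N t \<omega> = 2 * k} = ?A - (?A \<inter> ?P)"
    using running_max_bounds[of _ t k] t by (force simp: even_event_def)
  moreover have "prob (?A - (?A \<inter> ?P)) = prob ?A - prob (?A \<inter> ?P)"
    by (rule finite_measure_Diff) auto
  ultimately show ?thesis
    using prob_even_event_pos[OF t, of k]
    by (simp add: cond_prob_def even_event_def[symmetric] diff_divide_distrib)
qed

end

theorem mainTheorem17:
  fixes M :: "'a measure" and rate c t :: real
    and N :: "real \<Rightarrow> 'a \<Rightarrow> nat" and V0 :: "'a \<Rightarrow> real"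
  assumes "symmetric_telegraph M rate N c V0"
    and "0 < t"
  shows "(\<forall>m k :: nat. 1 \<le> m \<longrightarrow>
           cond_expectation M (\<lambda>\<omega>. running_max (telegraph V0 N) t \<omega> ^ m)
             (\<lambda>\<omega>. V0 \<omega> = - c \<and> N t \<omega> = 2 * k) =
           fact (2 * k) * (c * t) ^ m / (2 ^ (2 * k) * fact k) *
             (Gamma ((real m + 1) / 2) / Gamma (real k + (real m + 1) / 2)
              - Gamma (real m / 2 + 1) / Gamma (real k + 1 + real m / 2)))
       \<and> (\<forall>k :: nat.
           cond_expectation M (running_max (telegraph V0 N) t)
             (\<lambda>\<omega>. V0 \<omega> = - c \<and> N t \<omega> = 2 * k) =
           c * t * (fact (2 * k) / ((fact k)\<^sup>2 * 2 ^ (2 * k))) - c * t / (2 * real k + 1)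
         \<and> c * t * (fact (2 * k) / ((fact k)\<^sup>2 * 2 ^ (2 * k))) - c * t / (2 * real k + 1) =
           c * t * \<P>(\<omega> in M. running_max (telegraph V0 N) t \<omega> = 0
                     \<bar> V0 \<omega> = - c \<and> N t \<omega> = 2 * k) - c * t / (2 * real k + 1))"
proof -
  interpret symmetric_telegraph M rate N c V0 by fact
  have "cond_expectation M (running_max (telegraph V0 N) t) (\<lambda>\<omega>. V0 \<omega> = - c \<and> N t \<omega> = 2 * k) =
      c * t * (fact (2 * k) / ((fact k)\<^sup>2 * 2 ^ (2 * k))) - c * t / (2 * real k + 1)" for k
  proof -
    have "cond_expectation M (running_max (telegraph V0 N) t) (\<lambda>\<omega>. V0 \<omega> = - c \<and> N t \<omega> = 2 * k) =
        c * t * (fact (2 * k) / (2 ^ (2 * k) * fact k) *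
          (Gamma ((real 1 + 1) / 2) / Gamma (real k + (real 1 + 1) / 2)
           - Gamma (real 1 / 2 + 1) / Gamma (real k + 1 + real 1 / 2)))"
      using cond_expectation_running_max_power[OF \<open>0 < t\<close> order_refl, of k]
      by (simp only: power_one_right mult_ac times_divide_eq_right times_divide_eq_left)
    also have "\<dots> = c * t * (fact (2 * k) / ((fact k)\<^sup>2 * 2 ^ (2 * k))) - c * t / (2 * real k + 1)"
      unfolding moment_formula_1 by (simp add: right_diff_distrib)
    finally show ?thesis .
  qed
  then show ?thesis
    using cond_expectation_running_max_power[OF \<open>0 < t\<close>] cond_prob_running_max_zero[OF \<open>0 < t\<close>] by simp
qed

end
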